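(* Let $Q\subseteq\mathbb{R}^m$ be a closed set, let $g_1,\ldots,g_s\in\mathbb{R}[\mathrm{x},\mathrm{y}]$, and let $K=\{x\in\mathbb{R}^n : g_1(x,y)\ge 0,\ldots,g_s(x,y)\ge 0\ \ \forall y\in Q\}$. Let $\nu$ be a nonnegative Borel measure on $\mathbb{R}^m$ with $\operatorname{supp}(\nu)=Q$ satisfying the multivariate Carleman condition. Suppose that $\operatorname{QM}[g,\nu]$ is archimedean. If $f\in\mathbb{R}[\mathrm{x}]$ satisfies $f>0$ on $K$, then $f\in\operatorname{QM}[g,\nu]$.
   Context: Here $\mathrm{x}=(\mathrm{x}_1,\ldots,\mathrm{x}_n)$ and $\mathrm{y}=(\mathrm{y}_1,\ldots,\mathrm{y}_m)$ are tuples of variables. All measures are finite, and $\nu$ has finite moments of all orders. The measure $\nu$ satisfies the multivariate Carleman condition if $\sum_{d=1}^\infty\big(\int y_j^{2d}\,d\nu(y)\big)^{-\frac{1}{2d}}=\infty$ for $j=1,\ldots,m$ (a term with zero moment is read as $+\infty$). $\Sigma^2[\mathrm{x},\mathrm{y}]$ is the cone of sums of squares of polynomials in $\mathbb{R}[\mathrm{x},\mathrm{y}]$. With $g_0:=1$, the quadratic module associated to $g=(g_0,\ldots,g_s)$ and $\nu$ is $$\operatorname{QM}[g,\nu]:=\Big\{\sum_{j=0}^s\int \tau_j(\mathrm{x},y)g_j(\mathrm{x},y)\,d\nu(y)\ :\ \tau_0,\ldots,\tau_s\in\Sigma^2[\mathrm{x},\mathrm{y}]\Big\}\subseteq\mathbb{R}[\mathrm{x}].$$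 It is called archimedean if there is an integer $N>0$ with $N-\mathrm{x}_1^2-\cdots-\mathrm{x}_n^2\in\operatorname{QM}[g,\nu]$. *)

theory Defs
  imports "HOL-Analysis.Analysis"
begin

text \<open>
  Over the infinite field \<open>\<real>\<close> a polynomial is determined by the function it induces. Accordingly
  \<open>\<real>[x]\<close> and \<open>\<real>[x,y]\<close> are the sets of real polynomial functions on \<open>real ^ 'n\<close> and on
  \<open>(real ^ 'n) \<times> (real ^ 'm)\<close>, and an equation in \<open>\<real>[x]\<close> is an equation of functions.
\<close>

definition sum_of_squares :: "('a::real_normed_vector \<Rightarrow> real) set" where
  "sum_of_squares =
     {(\<lambda>z. \<Sum>i<k. (p i z)\<^sup>2) | (k::nat) (p :: nat \<Rightarrow> 'a \<Rightarrow> real).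
        \<forall>i<k. real_polynomial_function (p i)}"

definition measure_support :: "'a::topological_space measure \<Rightarrow> 'a set" where
  "measure_support \<nu> = {y. \<forall>U. open U \<and> y \<in> U \<longrightarrow> emeasure \<nu> U > 0}"

definition finite_moments :: "(real ^ 'm) measure \<Rightarrow> bool" where
  "finite_moments \<nu> \<longleftrightarrow>
     (\<forall>\<alpha> :: 'm \<Rightarrow> nat. integrable \<nu> (\<lambda>y. \<Prod>j\<in>UNIV. (y $ j) ^ (\<alpha> j)))"

text \<open>The zero case is explicit because \<open>0 powr a = 0\<close>, whereas the convention here is \<open>\<infinity>\<close>.\<close>

definition carleman_term :: "(real ^ 'm) measure \<Rightarrow> 'm \<Rightarrow> nat \<Rightarrow> ennreal" where
  "carleman_term \<nu> j d =
     (let M = (\<integral>y. (y $ j) ^ (2 * d) \<partial>\<nu>)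
      in if M = 0 then \<infinity> else ennreal (M powr (- 1 / (2 * real d))))"

text \<open>The shift by \<open>Suc\<close> makes the series start at \<open>d = 1\<close>.\<close>

definition multivariate_carleman :: "(real ^ 'm) measure \<Rightarrow> bool" where
  "multivariate_carleman \<nu> \<longleftrightarrow> (\<forall>j. (\<Sum>d. carleman_term \<nu> j (Suc d)) = \<infinity>)"

text \<open>
  The integral is taken pointwise in \<open>x\<close>. For polynomials \<open>\<tau> j\<close>, \<open>g j\<close> and a measure with finite
  moments, this is the function of the polynomial obtained by integrating coefficients.
\<close>

definition quadratic_module ::
  "nat \<Rightarrow> (nat \<Rightarrow> (real ^ 'n) \<times> (real ^ 'm) \<Rightarrow> real) \<Rightarrow> (real ^ 'm) measure
     \<Rightarrow> ((real ^ 'n) \<Rightarrow> real) set" where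
  "quadratic_module s g \<nu> =
     {(\<lambda>x. \<Sum>j\<le>s. \<integral>y. \<tau> j (x, y) * g j (x, y) \<partial>\<nu>) | \<tau>. \<forall>j\<le>s. \<tau> j \<in> sum_of_squares}"

definition archimedean :: "((real ^ 'n) \<Rightarrow> real) set \<Rightarrow> bool" where
  "archimedean M \<longleftrightarrow> (\<exists>N::int. N > 0 \<and> (\<lambda>x. of_int N - (\<Sum>i\<in>UNIV. (x $ i)\<^sup>2)) \<in> M)"

end

theory Submission
  imports Defs "HOL-Probability.Characteristic_Functions"
begin

text \<open>
  Two statements of different nature are combined. Write \<open>M\<close> for the quadratic module.

  The first is the archimedean Positivstellensatz: an archimedean quadratic module \<open>M\<close> contains every
  polynomial that is positive at all points where the members of \<open>M\<close> are nonnegative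
  (\<open>archimedean_positivstellensatz\<close>). If \<open>- 1\<close> is not in a quadratic module, Zorn's lemma extends it to a
  maximal one with this property, and maximality makes that one total: it contains \<open>a\<close> or \<open>- a\<close> for
  every polynomial \<open>a\<close>. In the archimedean case every \<open>a\<close> then has a value, the supremum of the reals
  \<open>r\<close> with \<open>a - r\<close> in the module, and this value is a ring homomorphism, hence evaluation at a point
  (\<open>\<alpha>_eval\<close>). Multiplicativity comes from the identity
  \<open>2 c (c\<^sup>2 - a\<^sup>2) = (c + a)\<^sup>2 (c - a) + (c - a)\<^sup>2 (c + a)\<close>: it shows that \<open>a\<^sup>2\<close> has value zero
  when \<open>a\<close> has. Applied to \<open>M - f \<cdot> \<Sigma>\<^sup>2\<close> this gives \<open>p f - 1 \<in> M\<close> for some sum of squares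
  \<open>p\<close>, and an explicit computation removes the factor \<open>p\<close>.

  The second identifies the points at which \<open>M\<close> is nonnegative with the points of \<open>K\<close>. Fix such a point
  \<open>x\<close> and put \<open>h(y) = g\<^sub>j(x, y)\<close>. Then \<open>\<integral> p\<^sup>2 h d\<nu> \<ge> 0\<close> for every polynomial \<open>p\<close> in \<open>y\<close>, and
  \<open>h \<ge> 0\<close> on the support of \<open>\<nu>\<close> is to be shown (\<open>nonneg_on_support\<close>). Were \<open>h\<close> negative at a point of the
  support, a bump function there would have \<open>\<integral> \<phi>\<^sup>2 h d\<nu> < 0\<close>, and approximating it by polynomials in the
  quadratic mean with weight \<open>\<bar>h\<bar>\<close> would give a contradiction.

  That approximation is where Carleman's condition enters. Replacing \<open>y\<close> by the vector of the
  \<open>sin (t y\<^sub>i) / t\<close> with small \<open>t\<close> turns the bump into a continuous function of bounded arguments, to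
  which the Stone-Weierstrass theorem applies, so it is enough that the functions \<open>sin (t y\<^sub>i) q(y)\<close> with
  polynomial \<open>q\<close> are limits of polynomials. The curve \<open>t \<mapsto> cis (t y\<^sub>i) q(y)\<close> has all its derivatives at
  \<open>t = 0\<close> in the space of polynomials, and the \<open>n\<close>-th derivative has norm at most a constant times the
  fourth root of \<open>\<integral> y\<^sub>i\<^sup>4\<^sup>n d\<nu>\<close>. A quasi-analytic curve whose derivatives at \<open>0\<close> all lie in a subspace
  stays in the closure of that subspace. Bang's proof of the Denjoy-Carleman theorem shows this
  (\<open>bang_vanishing\<close>): it rests on Taylor's inequality, so it applies to the distance from the
  polynomials in the place of the absolute value.
  Carleman's inequality for geometric means translates the divergence of Carleman's series into
  the divergence of the series of moment ratios that Bang's argument consumes.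
\<close>


section \<open>Quadratic modules of polynomials\<close>

text \<open>
  The introduction rule for linear functions is left out: its conclusion matches every goal, so it
  would pre-empt the structural rules.
\<close>

lemmas poly_intros =
  real_polynomial_function.intros(2-4) real_polynomial_function_diff real_polynomial_function_minus
  real_polynomial_function_power real_polynomial_function_divide real_polynomial_function_sum

lemma poly_inner: "real_polynomial_function (\<lambda>x::'a::real_inner. x \<bullet> b)"
  by (intro real_polynomial_function.intros(1) bounded_linear_inner_left)

lemma linear_as_coordinates:
  assumes "bounded_linear (l :: 'a::euclidean_space \<Rightarrow> real)"
  shows "l x = (\<Sum>b\<in>Basis. l b * (x \<bullet> b))"
proof -
  interpret bounded_linear l by fact
  have "l x = l (\<Sum>b\<in>Basis. (x \<bullet> b) *\<^sub>R b)" by (simp add: euclidean_representation)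
  then show ?thesis by (simp add: sum scaleR mult.commute)
qed

text \<open>
  A quadratic module of polynomial functions. Closure under multiplication by nonnegative constants
  is included in \<open>square_mult\<close>, because such constants are squares.
\<close>

locale polynomial_quadratic_module =
  fixes M :: "('a::real_normed_vector \<Rightarrow> real) set"
  assumes polynomial: "p \<in> M \<Longrightarrow> real_polynomial_function p"
    and one: "(\<lambda>_. 1) \<in> M"
    and add: "p \<in> M \<Longrightarrow> q \<in> M \<Longrightarrow> (\<lambda>x. p x + q x) \<in> M"
    and square_mult: "p \<in> M \<Longrightarrow> real_polynomial_function a \<Longrightarrow> (\<lambda>x. (a x)\<^sup>2 * p x) \<in> M"
begin

lemma scale:
  assumes "p \<in> M" "c \<ge> 0" shows "(\<lambda>x. c * p x) \<in> M"
  using square_mult[OF assms(1) real_polynomial_function.intros(2), of "sqrt c"] assms(2) by simp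

lemma nonneg_const: "c \<ge> 0 \<Longrightarrow> (\<lambda>_. c) \<in> M"
  using scale[OF one, of c] by simp

lemma square: "real_polynomial_function a \<Longrightarrow> (\<lambda>x. (a x)\<^sup>2) \<in> M"
  using square_mult[OF one, of a] by simp

lemma sum_mem:
  assumes "\<And>i. i < k \<Longrightarrow> p i \<in> M" shows "(\<lambda>x. \<Sum>i<(k::nat). p i x) \<in> M"
  using assms by (induction k) (auto intro: add nonneg_const[of 0, simplified])

lemma mult_sos:
  assumes "s \<in> sum_of_squares" "p \<in> M" shows "(\<lambda>x. s x * p x) \<in> M"
proof -
  obtain k a where s: "s = (\<lambda>z. \<Sum>i<k. (a i z)\<^sup>2)" and a: "\<forall>i<(k::nat). real_polynomial_function (a i)"
    using assms(1) unfolding sum_of_squares_def by auto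
  have "(\<lambda>x. \<Sum>i<k. (a i x)\<^sup>2 * p x) \<in> M"
    using a assms(2) by (intro sum_mem square_mult) auto
  then show ?thesis by (simp add: s sum_distrib_right)
qed

lemma sos_mem: "s \<in> sum_of_squares \<Longrightarrow> s \<in> M"
  using mult_sos[OF _ one, of s] by simp

end

lemma sos_add:
  assumes "s \<in> sum_of_squares" "t \<in> sum_of_squares"
  shows "(\<lambda>x. s x + t x) \<in> sum_of_squares"
proof -
  obtain k a where s: "s = (\<lambda>z. \<Sum>i<k. (a i z)\<^sup>2)" and a: "\<forall>i<(k::nat). real_polynomial_function (a i)"
    using assms(1) unfolding sum_of_squares_def by auto
  obtain l b where t: "t = (\<lambda>z. \<Sum>i<l. (b i z)\<^sup>2)" and b: "\<forall>i<(l::nat). real_polynomial_function (b i)"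
    using assms(2) unfolding sum_of_squares_def by auto
  define c where "c i = (if i < k then a i else b (i - k))" for i
  have "(\<Sum>i<k+l. (c i x)\<^sup>2) = s x + t x" for x
  proof -
    have "(\<Sum>i<k+l. (c i x)\<^sup>2) = (\<Sum>i<k. (c i x)\<^sup>2) + (\<Sum>i<l. (c (k+i) x)\<^sup>2)"
      by (induction l) auto
    then show ?thesis by (simp add: c_def s t)
  qed
  moreover have "\<forall>i<k+l. real_polynomial_function (c i)"
    using a b by (auto simp: c_def)
  ultimately show ?thesis unfolding sum_of_squares_def by (intro CollectI exI[of _ "k+l"] exI[of _ c]) auto
qed

lemma sos_square:
  assumes "real_polynomial_function a" shows "(\<lambda>x. (a x)\<^sup>2) \<in> sum_of_squares"
  unfolding sum_of_squares_def using assms by (intro CollectI exI[of _ 1] exI[of _ "\<lambda>_. a"]) auto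

lemma sos_zero: "(\<lambda>x. 0) \<in> sum_of_squares"
  unfolding sum_of_squares_def by (intro CollectI exI[of _ 0]) auto

lemma sos_square_mult:
  assumes "s \<in> sum_of_squares" "real_polynomial_function a"
  shows "(\<lambda>x. (a x)\<^sup>2 * s x) \<in> sum_of_squares"
proof -
  obtain k b where s: "s = (\<lambda>z. \<Sum>i<k. (b i z)\<^sup>2)" and b: "\<forall>i<(k::nat). real_polynomial_function (b i)"
    using assms(1) unfolding sum_of_squares_def by auto
  show ?thesis unfolding sum_of_squares_def
    using b assms(2)
    by (intro CollectI exI[of _ k] exI[of _ "\<lambda>i x. a x * b i x"]) (auto simp: s sum_distrib_left power_mult_distrib)
qed

lemma sos_polynomial:
  assumes "s \<in> sum_of_squares" shows "real_polynomial_function s"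
  using assms unfolding sum_of_squares_def by (auto intro!: real_polynomial_function_sum real_polynomial_function_power)

section \<open>Archimedean quadratic modules\<close>

locale archimedean_quadratic_module = polynomial_quadratic_module M
  for M :: "('a::euclidean_space \<Rightarrow> real) set" +
  fixes N :: real
  assumes ball: "(\<lambda>x. N - (norm x)\<^sup>2) \<in> M"
begin

text \<open>
  Boundedness relative to the order that \<open>M\<close> induces. Such polynomials form a ring, and the
  archimedean axiom puts the coordinates into it, so that every polynomial is bounded.
\<close>

definition bounded_poly :: "('a \<Rightarrow> real) \<Rightarrow> bool" where
  "bounded_poly a \<longleftrightarrow> real_polynomial_function a \<and> (\<exists>c. (\<lambda>x. c - a x) \<in> M \<and> (\<lambda>x. c + a x) \<in> M)"

text \<open>
  Multiplying \<open>c - a\<close> by \<open>c + a\<close> would require products of members of \<open>M\<close>; multiplying each factor by the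
  square of the other and adding gives \<open>2 c (c\<^sup>2 - a\<^sup>2)\<close> with squares as the only multipliers.
\<close>

lemma diff_of_squares_mem:
  assumes "real_polynomial_function a" "c > 0" "(\<lambda>x. c - a x) \<in> M" "(\<lambda>x. c + a x) \<in> M"
  shows "(\<lambda>x. c\<^sup>2 - (a x)\<^sup>2) \<in> M"
proof -
  have "(\<lambda>x. (c + a x)\<^sup>2 * (c - a x)) \<in> M" "(\<lambda>x. (c - a x)\<^sup>2 * (c + a x)) \<in> M"
    using assms by (auto intro!: square_mult)
  from scale[OF add[OF this], of "1 / (2 * c)"] have
    "(\<lambda>x. 1 / (2 * c) * ((c + a x)\<^sup>2 * (c - a x) + (c - a x)\<^sup>2 * (c + a x))) \<in> M"
    using assms(2) by simp
  moreover have "1 / (2 * c) * ((c + u)\<^sup>2 * (c - u) + (c - u)\<^sup>2 * (c + u)) = c\<^sup>2 - u\<^sup>2" for u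
    using assms(2) by (simp add: field_simps power2_eq_square)
  ultimately show ?thesis by simp
qed

lemma bounded_poly_pos:
  assumes "bounded_poly a"
  obtains c where "c > d" "(\<lambda>x. c - a x) \<in> M" "(\<lambda>x. c + a x) \<in> M"
proof -
  obtain c where c: "(\<lambda>x. c - a x) \<in> M" "(\<lambda>x. c + a x) \<in> M"
    using assms bounded_poly_def by auto
  let ?e = "max 0 (d + 1 - c)"
  have "(\<lambda>x. (c - a x) + ?e) \<in> M" "(\<lambda>x. (c + a x) + ?e) \<in> M"
    by (intro add nonneg_const c; simp)+
  then show ?thesis using that[of "c + ?e"] by (simp add: algebra_simps)
qed

lemma bounded_poly_const: "bounded_poly (\<lambda>_. c)"
  unfolding bounded_poly_def by (auto intro!: exI[of _ "\<bar>c\<bar>"] nonneg_const)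

lemma bounded_poly_add:
  assumes "bounded_poly a" "bounded_poly b" shows "bounded_poly (\<lambda>x. a x + b x)"
proof -
  obtain c d where "(\<lambda>x. c - a x) \<in> M" "(\<lambda>x. c + a x) \<in> M" "(\<lambda>x. d - b x) \<in> M" "(\<lambda>x. d + b x) \<in> M"
    using assms bounded_poly_def by auto
  from add[OF this(1,3)] add[OF this(2,4)] show ?thesis
    using assms unfolding bounded_poly_def by (auto intro!: exI[of _ "c + d"] simp: algebra_simps)
qed

lemma bounded_poly_square:
  assumes "bounded_poly a" shows "bounded_poly (\<lambda>x. (a x)\<^sup>2)"
proof -
  obtain c where c: "c > 0" "(\<lambda>x. c - a x) \<in> M" "(\<lambda>x. c + a x) \<in> M"
    using bounded_poly_pos[OF assms] .
  have a: "real_polynomial_function a" using assms bounded_poly_def by auto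
  have "(\<lambda>x. c\<^sup>2 + (a x)\<^sup>2) \<in> M" by (intro add nonneg_const square a) auto
  then show ?thesis
    using diff_of_squares_mem[OF a c] a unfolding bounded_poly_def by auto
qed

lemma bounded_poly_scale:
  assumes "bounded_poly a" shows "bounded_poly (\<lambda>x. c * a x)"
proof -
  obtain d where d: "(\<lambda>x. d - a x) \<in> M" "(\<lambda>x. d + a x) \<in> M"
    using assms bounded_poly_def by auto
  have "(\<lambda>x. \<bar>c\<bar> * d - c * a x) \<in> M \<and> (\<lambda>x. \<bar>c\<bar> * d + c * a x) \<in> M"
    using scale[OF d(1), of "\<bar>c\<bar>"] scale[OF d(2), of "\<bar>c\<bar>"]
    by (cases "c \<ge> 0") (auto simp: algebra_simps abs_if)
  then show ?thesis using assms unfolding bounded_poly_def by auto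
qed

lemma bounded_poly_mult:
  assumes "bounded_poly a" "bounded_poly b" shows "bounded_poly (\<lambda>x. a x * b x)"
proof -
  \<comment> \<open>polarisation reduces products to squares\<close>
  have "bounded_poly (\<lambda>x. 1/4 * (a x + b x)\<^sup>2 + (- 1/4) * (a x + (-1) * b x)\<^sup>2)"
    by (intro bounded_poly_add bounded_poly_scale bounded_poly_square assms)
  moreover have "1/4 * (u + v)\<^sup>2 + (- 1/4) * (u + (-1) * v)\<^sup>2 = u * v" for u v :: real
    by (simp add: power2_eq_square field_simps)
  ultimately show ?thesis by simp
qed

text \<open>
  From \<open>N - \<bar>x\<bar>\<^sup>2\<close> in \<open>M\<close> one gets \<open>N - u\<^sup>2\<close> in \<open>M\<close> for each coordinate \<open>u\<close>, by adding the squares of the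
  other ones; adding \<open>(1 \<plusminus> u)\<^sup>2\<close> leaves \<open>N + 1 \<plusminus> 2 u\<close>.
\<close>

lemma bounded_poly_inner:
  assumes "b \<in> Basis" shows "bounded_poly (\<lambda>x. x \<bullet> b)"
proof -
  have *: "(\<lambda>x. \<Sum>i\<in>I. (x \<bullet> i)\<^sup>2) \<in> M" if "finite I" for I
    using that by (induction) (auto intro!: add square poly_inner nonneg_const[of 0, simplified])
  have "(\<lambda>x. (N - (norm x)\<^sup>2) + (\<Sum>i\<in>Basis-{b}. (x \<bullet> i)\<^sup>2)) \<in> M"
    by (intro add ball *) auto
  moreover have "(norm x)\<^sup>2 = (x \<bullet> b)\<^sup>2 + (\<Sum>i\<in>Basis-{b}. (x \<bullet> i)\<^sup>2)" for x :: 'a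
    unfolding power2_norm_eq_inner euclidean_inner[of x x]
    using assms by (simp add: sum.remove[of _ b] power2_eq_square)
  ultimately have 1: "(\<lambda>x. N - (x \<bullet> b)\<^sup>2) \<in> M" by simp
  have 2: "(\<lambda>x. 1/2 * ((N - (x \<bullet> b)\<^sup>2) + (1 - x \<bullet> b)\<^sup>2)) \<in> M"
       "(\<lambda>x. 1/2 * ((N - (x \<bullet> b)\<^sup>2) + (1 + x \<bullet> b)\<^sup>2)) \<in> M"
    using 1 poly_inner by (intro scale add square; force)+
  have 3: "1/2 * ((N - u\<^sup>2) + (1 - u)\<^sup>2) = (N + 1)/2 - u" "1/2 * ((N - u\<^sup>2) + (1 + u)\<^sup>2) = (N + 1)/2 + u" for u
    by (simp_all add: power2_eq_square field_simps)
  have "(\<lambda>x. (N + 1)/2 - x \<bullet> b) \<in> M \<and> (\<lambda>x. (N + 1)/2 + x \<bullet> b) \<in> M"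
    using 2 unfolding 3 by blast
  then show ?thesis unfolding bounded_poly_def using poly_inner by blast
qed

lemma poly_bounded:
  assumes "real_polynomial_function a" shows "bounded_poly a"
  using assms
proof induction
  case (linear l)
  have "bounded_poly (\<lambda>x. \<Sum>b\<in>I. l b * (x \<bullet> b))" if "finite I" "I \<subseteq> Basis" for I
    using that
    by induction (auto intro!: bounded_poly_add bounded_poly_scale bounded_poly_inner bounded_poly_const)
  from this[of Basis] show ?case using linear_as_coordinates[OF linear] by (metis (no_types, lifting) ext finite_Basis order_refl)
qed (auto intro: bounded_poly_const bounded_poly_add bounded_poly_mult)

end

section \<open>Total quadratic modules are given by points\<close>

locale total_quadratic_module = archimedean_quadratic_module M N
  for M :: "('a::euclidean_space \<Rightarrow> real) set" and N +
  assumes proper: "(\<lambda>_. -1) \<notin> M"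
    and total: "real_polynomial_function a \<Longrightarrow> a \<in> M \<or> (\<lambda>x. - a x) \<in> M"
begin

lemma const_mem_iff: "(\<lambda>_. c) \<in> M \<longleftrightarrow> c \<ge> 0"
proof
  assume c: "(\<lambda>_. c) \<in> M"
  show "c \<ge> 0"
  proof (rule ccontr)
    assume "\<not> c \<ge> 0"
    then have "(\<lambda>_. (1 / - c) * c) \<in> M" by (intro scale c) (auto simp: field_simps)
    then show False using proper \<open>\<not> c \<ge> 0\<close> by simp
  qed
qed (rule nonneg_const)

text \<open>
  The value that the order induced by \<open>M\<close> assigns to a polynomial: for a total \<open>M\<close>, the cut
  between the constants below and above \<open>a\<close>.
\<close>

definition \<alpha> :: "('a \<Rightarrow> real) \<Rightarrow> real" where
  "\<alpha> a = Sup {r. (\<lambda>x. a x - r) \<in> M}"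

lemma
  assumes a: "real_polynomial_function a"
  shows mem_below_\<alpha>: "r < \<alpha> a \<Longrightarrow> (\<lambda>x. a x - r) \<in> M"
    and mem_above_\<alpha>: "r > \<alpha> a \<Longrightarrow> (\<lambda>x. r - a x) \<in> M"
    and \<alpha>_ge: "(\<lambda>x. a x - r) \<in> M \<Longrightarrow> r \<le> \<alpha> a"
    and \<alpha>_le: "(\<lambda>x. r - a x) \<in> M \<Longrightarrow> \<alpha> a \<le> r"
proof -
  let ?S = "{r. (\<lambda>x. a x - r) \<in> M}"
  obtain c where c: "(\<lambda>x. c - a x) \<in> M" "(\<lambda>x. c + a x) \<in> M"
    using poly_bounded[OF a] bounded_poly_def by auto
  have ne: "- c \<in> ?S" using c by (simp add: algebra_simps)
  have le: "s \<le> d" if "s \<in> ?S" "(\<lambda>x. d - a x) \<in> M" for s d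
  proof -
    have "(\<lambda>x. (a x - s) + (d - a x)) \<in> M" using that by (intro add) auto
    then show ?thesis using const_mem_iff[of "d - s"] by simp
  qed
  have bdd: "bdd_above ?S" using le[OF _ c(1)] by (intro bdd_aboveI) auto
  show ge: "(\<lambda>x. a x - r) \<in> M \<Longrightarrow> r \<le> \<alpha> a" for r
    unfolding \<alpha>_def by (intro cSup_upper bdd) auto
  show "(\<lambda>x. r - a x) \<in> M \<Longrightarrow> \<alpha> a \<le> r"
    unfolding \<alpha>_def using ne le by (intro cSup_least) blast+
  show "(\<lambda>x. a x - r) \<in> M" if "r < \<alpha> a"
  proof -
    obtain s where s: "s \<in> ?S" "r < s"
      using \<open>r < \<alpha> a\<close> less_cSup_iff[OF _ bdd, of r] ne unfolding \<alpha>_def by blast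
    have "(\<lambda>x. (a x - s) + (s - r)) \<in> M" using s by (intro add nonneg_const) auto
    then show ?thesis by simp
  qed
  show "(\<lambda>x. r - a x) \<in> M" if "r > \<alpha> a"
    using total[of "\<lambda>x. a x - r"] ge[of r] that real_polynomial_function_diff[OF a] by auto
qed

lemma \<alpha>_nonneg: "a \<in> M \<Longrightarrow> \<alpha> a \<ge> 0"
  using \<alpha>_ge[of a 0] polynomial by simp

lemma \<alpha>_const: "\<alpha> (\<lambda>_. c) = c"
  using \<alpha>_ge[of "\<lambda>_. c" c] \<alpha>_le[of "\<lambda>_. c" c] nonneg_const[of 0] real_polynomial_function.intros(2)[of c] by (intro antisym) auto

lemma \<alpha>_add:
  assumes a: "real_polynomial_function a" and b: "real_polynomial_function b"
  shows "\<alpha> (\<lambda>x. a x + b x) = \<alpha> a + \<alpha> b"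
proof (rule antisym; rule field_le_epsilon)
  have ab: "real_polynomial_function (\<lambda>x. a x + b x)" using a b by auto
  fix e :: real assume "e > 0"
  have "(\<lambda>x. ((\<alpha> a + e/2) - a x) + ((\<alpha> b + e/2) - b x)) \<in> M"
    using \<open>e > 0\<close> by (intro add mem_above_\<alpha> a b) auto
  then show "\<alpha> (\<lambda>x. a x + b x) \<le> \<alpha> a + \<alpha> b + e"
    by (intro \<alpha>_le ab) (simp add: algebra_simps)
  have "(\<lambda>x. (a x - (\<alpha> a - e/2)) + (b x - (\<alpha> b - e/2))) \<in> M"
    using \<open>e > 0\<close> by (intro add mem_below_\<alpha> a b) auto
  then have "\<alpha> a + \<alpha> b - e \<le> \<alpha> (\<lambda>x. a x + b x)"
    by (intro \<alpha>_ge ab) (simp add: algebra_simps)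
  then show "\<alpha> a + \<alpha> b \<le> \<alpha> (\<lambda>x. a x + b x) + e" by simp
qed

lemma \<alpha>_uminus:
  assumes a: "real_polynomial_function a"
  shows "\<alpha> (\<lambda>x. - a x) = - \<alpha> a"
  using \<alpha>_add[OF a real_polynomial_function_minus[OF a]] \<alpha>_const[of 0] by simp

text \<open>
  If \<open>a\<close> has value zero, then \<open>\<epsilon> - a\<close> and \<open>\<epsilon> + a\<close> are in \<open>M\<close> for all \<open>\<epsilon> > 0\<close>, hence so is
  \<open>\<epsilon>\<^sup>2 - a\<^sup>2\<close>. This makes the value multiplicative.
\<close>

lemma \<alpha>_square_null:
  assumes a: "real_polynomial_function a" and "\<alpha> a = 0"
  shows "\<alpha> (\<lambda>x. (a x)\<^sup>2) = 0"
proof (rule antisym)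
  have a2: "real_polynomial_function (\<lambda>x. (a x)\<^sup>2)" using a by auto
  show "0 \<le> \<alpha> (\<lambda>x. (a x)\<^sup>2)" by (intro \<alpha>_nonneg square a)
  show "\<alpha> (\<lambda>x. (a x)\<^sup>2) \<le> 0"
  proof (rule field_le_epsilon)
    fix e :: real assume "e > 0"
    then have "sqrt e > 0" by simp
    moreover have "(\<lambda>x. sqrt e - a x) \<in> M" "(\<lambda>x. sqrt e + a x) \<in> M"
      using mem_above_\<alpha>[OF a, of "sqrt e"] mem_below_\<alpha>[OF a, of "- sqrt e"] assms(2) \<open>e > 0\<close>
      by (auto simp: add.commute)
    ultimately have "(\<lambda>x. (sqrt e)\<^sup>2 - (a x)\<^sup>2) \<in> M" by (intro diff_of_squares_mem a)
    then show "\<alpha> (\<lambda>x. (a x)\<^sup>2) \<le> 0 + e" using \<open>e > 0\<close> by (intro \<alpha>_le a2) auto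
  qed
qed

lemma \<alpha>_scale:
  assumes a: "real_polynomial_function a"
  shows "\<alpha> (\<lambda>x. c * a x) = c * \<alpha> a"
proof -
  have pos: "\<alpha> (\<lambda>x. c * a x) \<le> c * \<alpha> a" if "c > 0" "real_polynomial_function a" for c a
  proof (rule field_le_epsilon)
    fix e :: real assume "e > 0"
    have "(\<lambda>x. c * ((\<alpha> a + e / c) - a x)) \<in> M"
      using \<open>e > 0\<close> that by (intro scale mem_above_\<alpha>) auto
    then have "(\<lambda>x. (c * \<alpha> a + e) - c * a x) \<in> M" using that by (simp add: algebra_simps)
    then show "\<alpha> (\<lambda>x. c * a x) \<le> c * \<alpha> a + e" using that by (intro \<alpha>_le) auto
  qed
  have pos_eq: "\<alpha> (\<lambda>x. c * a x) = c * \<alpha> a" if "c > 0" for c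
  proof (rule antisym)
    have "real_polynomial_function (\<lambda>x. c * a x)" using a by auto
    then show "c * \<alpha> a \<le> \<alpha> (\<lambda>x. c * a x)"
      using pos[OF that real_polynomial_function_minus[OF a]] \<alpha>_uminus \<alpha>_uminus[OF a] by simp
  qed (rule pos[OF that a])
  consider "c > 0" | "c = 0" | "c < 0" by linarith
  then show ?thesis
  proof cases
    case 3
    then have "\<alpha> (\<lambda>x. - (c * a x)) = - (c * \<alpha> a)" using pos_eq[of "- c"] by simp
    moreover have "real_polynomial_function (\<lambda>x. c * a x)" using a by auto
    ultimately show ?thesis using \<alpha>_uminus[of "\<lambda>x. c * a x"] by simp
  qed (use pos_eq \<alpha>_const[of 0] in auto)
qed

text \<open>
  Shift \<open>a\<close> by its value to make it null, and expand the square.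
\<close>

lemma \<alpha>_square:
  assumes a: "real_polynomial_function a"
  shows "\<alpha> (\<lambda>x. (a x)\<^sup>2) = (\<alpha> a)\<^sup>2"
proof -
  let ?b = "\<lambda>x. a x + (- \<alpha> a)"
  have "\<alpha> ?b = 0" by (subst \<alpha>_add) (use a \<alpha>_const in auto)
  then have "\<alpha> (\<lambda>x. (?b x)\<^sup>2) = 0" using a by (intro \<alpha>_square_null) auto
  also have "(\<lambda>x. (?b x)\<^sup>2) = (\<lambda>x. (a x)\<^sup>2 + ((- 2 * \<alpha> a) * a x + (\<alpha> a)\<^sup>2))"
    by (auto simp: power2_eq_square algebra_simps)
  also have "\<alpha> \<dots> = \<alpha> (\<lambda>x. (a x)\<^sup>2) + ((- 2 * \<alpha> a) * \<alpha> a + (\<alpha> a)\<^sup>2)"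
    using a by (subst \<alpha>_add; (subst \<alpha>_add)?; (subst \<alpha>_scale)?; (subst \<alpha>_const)?; force)
  finally show ?thesis by (simp add: power2_eq_square)
qed

lemma \<alpha>_mult:
  assumes a: "real_polynomial_function a" and b: "real_polynomial_function b"
  shows "\<alpha> (\<lambda>x. a x * b x) = \<alpha> a * \<alpha> b"
proof -
  have ab: "real_polynomial_function (\<lambda>x. a x * b x)" using a b by auto
  have "(\<alpha> a + \<alpha> b)\<^sup>2 = \<alpha> (\<lambda>x. (a x + b x)\<^sup>2)"
    using \<alpha>_square[OF real_polynomial_function.intros(3)[OF a b]] \<alpha>_add[OF a b] by simp
  also have "(\<lambda>x. (a x + b x)\<^sup>2) = (\<lambda>x. (a x)\<^sup>2 + ((b x)\<^sup>2 + 2 * (a x * b x)))"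
    by (auto simp: power2_eq_square algebra_simps)
  also have "\<alpha> \<dots> = \<alpha> (\<lambda>x. (a x)\<^sup>2) + \<alpha> (\<lambda>x. (b x)\<^sup>2 + 2 * (a x * b x))"
    using a b by (intro \<alpha>_add poly_intros)
  also have "\<alpha> (\<lambda>x. (b x)\<^sup>2 + 2 * (a x * b x)) = \<alpha> (\<lambda>x. (b x)\<^sup>2) + \<alpha> (\<lambda>x. 2 * (a x * b x))"
    using a b by (intro \<alpha>_add poly_intros)
  also have "\<alpha> (\<lambda>x. 2 * (a x * b x)) = 2 * \<alpha> (\<lambda>x. a x * b x)" by (rule \<alpha>_scale[OF ab])
  finally show ?thesis using \<alpha>_square[OF a] \<alpha>_square[OF b] by (simp add: power2_eq_square algebra_simps)
qed

text \<open>
  A ring homomorphism from polynomials to reals that fixes the constants is evaluation at the point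
  whose coordinates are the values of the coordinate functions.
\<close>

lemma \<alpha>_eval:
  obtains x where "\<And>a. real_polynomial_function a \<Longrightarrow> \<alpha> a = a x"
proof
  let ?x = "\<Sum>b\<in>Basis. \<alpha> (\<lambda>x. x \<bullet> b) *\<^sub>R b"
  fix a :: "'a \<Rightarrow> real" assume "real_polynomial_function a"
  then show "\<alpha> a = a ?x"
  proof induction
    case (linear l)
    have "\<alpha> (\<lambda>x. \<Sum>b\<in>I. l b * (x \<bullet> b)) = (\<Sum>b\<in>I. l b * \<alpha> (\<lambda>x. x \<bullet> b))" if "finite I" for I
      using that
    proof induction
      case (insert i I)
      have "\<alpha> (\<lambda>x. l i * (x \<bullet> i) + (\<Sum>b\<in>I. l b * (x \<bullet> b))) =
        \<alpha> (\<lambda>x. l i * (x \<bullet> i)) + \<alpha> (\<lambda>x. \<Sum>b\<in>I. l b * (x \<bullet> b))"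
        using insert.hyps poly_inner by (intro \<alpha>_add poly_intros)
      then show ?case using insert by (simp add: \<alpha>_scale[OF poly_inner])
    qed (simp add: \<alpha>_const)
    from this[of Basis] have "\<alpha> l = (\<Sum>b\<in>Basis. l b * \<alpha> (\<lambda>x. x \<bullet> b))"
      using linear_as_coordinates[OF linear] by (metis (no_types, lifting) ext finite_Basis)
    also have "\<dots> = l ?x" by (subst linear_as_coordinates[OF linear]) simp
    finally show ?case .
  qed (auto simp: \<alpha>_const \<alpha>_add \<alpha>_mult)
qed

end

section \<open>The archimedean Positivstellensatz\<close>

text \<open>
  The quadratic module generated by \<open>M\<close> and \<open>a\<close>, when \<open>M\<close> is one and \<open>a\<close> is a polynomial.
\<close>

definition adjoin :: "('a::real_normed_vector \<Rightarrow> real) set \<Rightarrow> ('a \<Rightarrow> real) \<Rightarrow> ('a \<Rightarrow> real) set" where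
  "adjoin M a = {(\<lambda>x. q x + t x * a x) | q t. q \<in> M \<and> t \<in> sum_of_squares}"

lemma adjoinI: "q \<in> M \<Longrightarrow> t \<in> sum_of_squares \<Longrightarrow> (\<And>x. p x = q x + t x * a x) \<Longrightarrow> p \<in> adjoin M a"
  unfolding adjoin_def by auto

context polynomial_quadratic_module
begin

lemma subset_adjoin: "M \<subseteq> adjoin M a"
  by (auto intro!: adjoinI[of _ M "\<lambda>_. 0"] sos_zero)

lemma mem_adjoin: "a \<in> adjoin M a"
  using sos_square[of "\<lambda>_. 1"] real_polynomial_function.intros(2)[of 1]
  by (auto intro!: adjoinI[of "\<lambda>_. 0" M "\<lambda>_. 1"] nonneg_const)

lemma adjoin_quadratic_module:
  assumes a: "real_polynomial_function a"
  shows "polynomial_quadratic_module (adjoin M a)"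
proof
  show "(\<lambda>_. 1) \<in> adjoin M a" using subset_adjoin one by blast
next
  fix p assume "p \<in> adjoin M a"
  then obtain q t where qt: "q \<in> M" "t \<in> sum_of_squares" "p = (\<lambda>x. q x + t x * a x)"
    unfolding adjoin_def by auto
  show "real_polynomial_function p" using polynomial[OF qt(1)] sos_polynomial[OF qt(2)] a qt(3) by auto
  {
    fix b :: "'a \<Rightarrow> real" assume b: "real_polynomial_function b"
    show "(\<lambda>x. (b x)\<^sup>2 * p x) \<in> adjoin M a"
      by (rule adjoinI[OF square_mult[OF qt(1) b] sos_square_mult[OF qt(2) b]]) (simp add: qt algebra_simps)
  }
  fix p' assume "p' \<in> adjoin M a"
  then obtain q' t' where qt': "q' \<in> M" "t' \<in> sum_of_squares" "p' = (\<lambda>x. q' x + t' x * a x)"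
    unfolding adjoin_def by auto
  show "(\<lambda>x. p x + p' x) \<in> adjoin M a"
    by (rule adjoinI[OF add[OF qt(1) qt'(1)] sos_add[OF qt(2) qt'(2)]]) (simp add: qt qt' algebra_simps)
qed

text \<open>
  The set of \<open>p\<close> with \<open>p\<close> and \<open>- p\<close> in \<open>M\<close> is an ideal, since every polynomial is a difference of two
  squares.
\<close>

lemma support_absorbs_polynomials:
  assumes "p \<in> M" "(\<lambda>x. - p x) \<in> M" and a: "real_polynomial_function a"
  shows "(\<lambda>x. p x * a x) \<in> M"
proof -
  have "(\<lambda>x. ((a x + 1)/2)\<^sup>2 * p x + ((a x - 1)/2)\<^sup>2 * (- p x)) \<in> M"
    using a by (intro add square_mult assms poly_intros)
  moreover have "((u + 1)/2)\<^sup>2 * v + ((u - 1)/2)\<^sup>2 * (- v) = v * u" for u v :: real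
    by (simp add: field_simps power2_eq_square)
  ultimately show ?thesis by simp
qed

text \<open>
  If neither \<open>a\<close> nor \<open>- a\<close> were in \<open>M\<close>, adjoining either one would produce
  \<open>-1 = q + t a\<close> and \<open>-1 = q' - t' a\<close>. Multiplying crosswise by \<open>t'\<close> and \<open>t\<close> eliminates \<open>a\<close> and leaves
  \<open>- t - t'\<close> in \<open>M\<close>, so \<open>t\<close> and \<open>- t\<close> are both in \<open>M\<close>. Then \<open>t a\<close> is in \<open>M\<close>, and \<open>-1\<close> as well.
\<close>

lemma maximal_total:
  assumes proper: "(\<lambda>_. -1) \<notin> M"
    and maximal: "\<And>M'. polynomial_quadratic_module M' \<Longrightarrow> M \<subseteq> M' \<Longrightarrow> (\<lambda>_. -1) \<notin> M' \<Longrightarrow> M' = M"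
    and a: "real_polynomial_function a"
  shows "a \<in> M \<or> (\<lambda>x. - a x) \<in> M"
proof (rule ccontr)
  assume not: "\<not> ?thesis"
  have ex: "\<exists>q t. q \<in> M \<and> t \<in> sum_of_squares \<and> (\<forall>x. -1 = q x + t x * b x)"
    if "real_polynomial_function b" "b \<notin> M" for b
  proof -
    have "(\<lambda>_. -1) \<in> adjoin M b"
      using maximal[OF adjoin_quadratic_module[OF that(1)] subset_adjoin] mem_adjoin that(2) by blast
    then show ?thesis unfolding adjoin_def by (auto dest: fun_cong)
  qed
  obtain q t where qt: "q \<in> M" "t \<in> sum_of_squares" "\<And>x. -1 = q x + t x * a x"
    using ex[OF a] not by auto
  obtain q' t' where qt': "q' \<in> M" "t' \<in> sum_of_squares" "\<And>x. -1 = q' x + t' x * (- a x)"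
    using ex[of "\<lambda>x. - a x"] a not by auto
  have "(\<lambda>x. t' x * q x + t x * q' x) \<in> M" by (intro add mult_sos qt qt')
  moreover have eq: "t' x * q x + t x * q' x = - t x - t' x" for x
  proof -
    have q: "q x = -1 - t x * a x" and q': "q' x = -1 + t' x * a x"
      using qt(3)[of x] qt'(3)[of x] by linarith+
    show ?thesis unfolding q q' by (simp add: algebra_simps)
  qed
  ultimately have "(\<lambda>x. - t x - t' x) \<in> M" by simp
  from add[OF this sos_mem[OF qt'(2)]] have "(\<lambda>x. (- t x - t' x) + t' x) \<in> M" .
  then have "(\<lambda>x. - t x) \<in> M" by simp
  then have "(\<lambda>x. t x * a x) \<in> M" using support_absorbs_polynomials[OF sos_mem[OF qt(2)] _ a] by simp
  from add[OF qt(1) this] show False using proper unfolding qt(3)[symmetric] by simp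
qed

text \<open>
  Zorn's lemma; properness is preserved along chains because it forbids a single element.
\<close>

lemma obtain_maximal:
  assumes proper: "(\<lambda>_. -1) \<notin> M"
  obtains M' where "polynomial_quadratic_module M'" "M \<subseteq> M'" "(\<lambda>_. -1) \<notin> M'"
    "\<And>M''. polynomial_quadratic_module M'' \<Longrightarrow> M' \<subseteq> M'' \<Longrightarrow> (\<lambda>_. -1) \<notin> M'' \<Longrightarrow> M'' = M'"
proof -
  let ?A = "{M'. polynomial_quadratic_module M' \<and> M \<subseteq> M' \<and> (\<lambda>_. -1) \<notin> M'}"
  have "\<exists>M'\<in>?A. \<forall>X\<in>?A. M' \<subseteq> X \<longrightarrow> X = M'"
  proof (rule subset_Zorn_nonempty)
    show "?A \<noteq> {}" using proper polynomial_quadratic_module_axioms by auto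
  next
    fix \<C> assume ne: "\<C> \<noteq> {}" and ch: "subset.chain ?A \<C>"
    then have A: "X \<in> ?A" if "X \<in> \<C>" for X using that unfolding subset.chain_def by auto
    have "polynomial_quadratic_module (\<Union>\<C>)"
    proof
      fix p assume "p \<in> \<Union>\<C>"
      then obtain X where X: "X \<in> \<C>" "p \<in> X" by auto
      interpret X: polynomial_quadratic_module X using A[OF X(1)] by simp
      show "real_polynomial_function p" by (rule X.polynomial[OF X(2)])
      show "(\<lambda>x. (a x)\<^sup>2 * p x) \<in> \<Union>\<C>" if "real_polynomial_function a" for a
        using X.square_mult[OF X(2) that] X(1) by auto
      fix q assume "q \<in> \<Union>\<C>"
      then obtain Y where Y: "Y \<in> \<C>" "q \<in> Y" by auto
      obtain Z where Z: "Z \<in> \<C>" "p \<in> Z" "q \<in> Z"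
        using X Y ch unfolding subset.chain_def by blast
      interpret Z: polynomial_quadratic_module Z using A[OF Z(1)] by simp
      show "(\<lambda>x. p x + q x) \<in> \<Union>\<C>" using Z.add[OF Z(2,3)] Z(1) by auto
    next
      obtain X where X: "X \<in> \<C>" using ne by auto
      interpret X: polynomial_quadratic_module X using A[OF X] by simp
      show "(\<lambda>_. 1) \<in> \<Union>\<C>" using X.one X by auto
    qed
    then show "\<Union>\<C> \<in> ?A" using ne A by auto
  qed
  then obtain M' where M': "M' \<in> ?A" "\<And>X. X \<in> ?A \<Longrightarrow> M' \<subseteq> X \<Longrightarrow> X = M'" by meson
  show ?thesis
  proof (rule that[of M'])
    fix X assume X: "polynomial_quadratic_module X" "M' \<subseteq> X" "(\<lambda>_. -1) \<notin> X"
    then have "X \<in> ?A" using M'(1) by auto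
    then show "X = M'" using M'(2) X(2) by metis
  qed (use M'(1) in auto)
qed

end

context archimedean_quadratic_module
begin

lemma point_of_proper:
  assumes proper: "(\<lambda>_. -1) \<notin> M"
  obtains x where "\<And>p. p \<in> M \<Longrightarrow> p x \<ge> 0"
proof -
  obtain M' where M': "polynomial_quadratic_module M'" "M \<subseteq> M'" "(\<lambda>_. -1) \<notin> M'"
    and max: "\<And>M''. polynomial_quadratic_module M'' \<Longrightarrow> M' \<subseteq> M'' \<Longrightarrow> (\<lambda>_. -1) \<notin> M'' \<Longrightarrow> M'' = M'"
    using obtain_maximal[OF proper] by metis
  interpret M': polynomial_quadratic_module M' by fact
  interpret T: total_quadratic_module M' N
    using M' ball M'.maximal_total[OF M'(3)] max by unfold_locales auto
  obtain x where x: "\<And>a. real_polynomial_function a \<Longrightarrow> T.\<alpha> a = a x" using T.\<alpha>_eval by metis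
  show ?thesis
    using that[of x] M'(2) T.\<alpha>_nonneg x polynomial by (metis subsetD)
qed

text \<open>
  The module generated by \<open>M\<close> and \<open>- f\<close> has no point, so it contains \<open>-1\<close>: this says
  \<open>p f = 1 + q\<close> with a sum of squares \<open>p\<close> and \<open>q \<in> M\<close>. To get rid of \<open>p\<close>, start from
  \<open>f + r \<in> M\<close> with a large constant \<open>r\<close>. As long as \<open>r \<ge> 0\<close>, the constant can be lowered by a fixed amount
  \<open>1 / k\<^sup>2\<close>, so after finitely many steps it is no longer positive.
\<close>

theorem archimedean_positivstellensatz:
  assumes f: "real_polynomial_function f"
    and pos: "\<And>x. (\<And>p. p \<in> M \<Longrightarrow> p x \<ge> 0) \<Longrightarrow> f x > 0"
  shows "f \<in> M"
proof -
  have "(\<lambda>_. -1) \<in> adjoin M (\<lambda>x. - f x)"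
  proof (rule ccontr)
    assume proper: "(\<lambda>_. -1) \<notin> adjoin M (\<lambda>x. - f x)"
    interpret F: polynomial_quadratic_module "adjoin M (\<lambda>x. - f x)"
      using f by (intro adjoin_quadratic_module) auto
    interpret F: archimedean_quadratic_module "adjoin M (\<lambda>x. - f x)" N
      using subset_adjoin ball by unfold_locales auto
    obtain x where x: "\<And>p. p \<in> adjoin M (\<lambda>x. - f x) \<Longrightarrow> p x \<ge> 0"
      using F.point_of_proper[OF proper] by blast
    have "f x > 0" using x subset_adjoin by (intro pos) auto
    moreover have "- f x \<ge> 0" using x[OF mem_adjoin] .
    ultimately show False by simp
  qed
  then obtain q p where q: "q \<in> M" and p: "p \<in> sum_of_squares" and "(\<lambda>_. -1) = (\<lambda>x. q x + p x * (- f x))"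
    unfolding adjoin_def by auto
  then have pf: "p x * f x = q x + 1" for x by (auto dest!: fun_cong[of _ _ x])
  have pp: "real_polynomial_function p" using sos_polynomial[OF p] .
  obtain c where c: "c > 1" "(\<lambda>x. c - p x) \<in> M"
    using bounded_poly_pos[OF poly_bounded[OF pp]] by metis
  have "real_polynomial_function (\<lambda>x. (p x)\<^sup>2 * f x)" using pp f by auto
  then obtain d where d: "d > 1" "(\<lambda>x. d - (p x)\<^sup>2 * f x) \<in> M"
    using bounded_poly_pos[OF poly_bounded] by metis
  define k where "k = max c d"
  have k: "k > 1" "k \<ge> c" "k \<ge> d" using c d by (auto simp: k_def)
  define e where "e = 1 / k\<^sup>2"
  have e: "e > 0" using k by (simp add: e_def)
  \<comment> \<open>uses \<open>k\<^sup>2 (f + r) = (k - p)\<^sup>2 (f + r) + (2 k p f - p\<^sup>2 f) + r p (2 k - p)\<close>, where the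
    middle term exceeds \<open>1\<close> by a member of \<open>M\<close> because \<open>p f = 1 + q\<close> and \<open>p\<^sup>2 f\<close> is bounded by \<open>d\<close>\<close>
  have step: "(\<lambda>x. f x + (r - e)) \<in> M" if r: "r \<ge> 0" "(\<lambda>x. f x + r) \<in> M" for r
  proof -
    have "(\<lambda>x. (k - p x)\<^sup>2 * (f x + r) + (2 * k * q x + ((d - (p x)\<^sup>2 * f x) + (2 * k - d - 1)))
        + r * (p x * ((c - p x) + (2 * k - c)))) \<in> M"
      using k r by (intro add[OF square_mult[OF r(2)] add] add scale[OF q] scale[OF mult_sos[OF p]]
          nonneg_const d(2) c(2) poly_intros pp) auto
    from scale[OF this, of e] have "(\<lambda>x. e * ((k - p x)\<^sup>2 * (f x + r) + (2 * k * q x + ((d - (p x)\<^sup>2 * f x) + (2 * k - d - 1)))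
        + r * (p x * ((c - p x) + (2 * k - c))))) \<in> M"
      using e by simp
    moreover have "e * ((k - p x)\<^sup>2 * (f x + r) + (2 * k * q x + ((d - (p x)\<^sup>2 * f x) + (2 * k - d - 1)))
        + r * (p x * ((c - p x) + (2 * k - c)))) = f x + (r - e)" for x
    proof -
      have "(k - p x)\<^sup>2 * (f x + r) + (2 * k * q x + ((d - (p x)\<^sup>2 * f x) + (2 * k - d - 1)))
        + r * (p x * ((c - p x) + (2 * k - c))) = k\<^sup>2 * (f x + r) - 2 * k * (p x * f x - q x - 1) - 1"
        by (simp add: power2_eq_square algebra_simps)
      also have "\<dots> = k\<^sup>2 * (f x + r) - 1" by (simp add: pf)
      finally show ?thesis using k by (simp add: e_def field_simps)
    qed
    ultimately show ?thesis by simp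
  qed
  obtain r0 where r0: "(\<lambda>x. r0 + f x) \<in> M" "r0 > 0" using bounded_poly_pos[OF poly_bounded[OF f], of 0] by metis
  have mono: "(\<lambda>x. f x + s) \<in> M" if "(\<lambda>x. f x + r) \<in> M" "r \<le> s" for r s
    using add[OF that(1) nonneg_const[of "s - r"]] that(2) by simp
  have iter: "(\<lambda>x. f x + max 0 (r0 - n * e)) \<in> M" for n :: nat
  proof (induction n)
    case (Suc n)
    have "(\<lambda>x. f x + (max 0 (r0 - n * e) - e)) \<in> M" by (rule step[OF _ Suc]) simp
    then show ?case by (rule mono) (simp add: algebra_simps e less_imp_le)
  qed (use r0 in \<open>simp add: add.commute\<close>)
  obtain n :: nat where "n * e > r0" using e ex_less_of_nat_mult by blast
  then have "max 0 (r0 - n * e) = 0" by simp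
  then show ?thesis using iter[of n] by simp
qed

end

section \<open>Carleman's inequality\<close>

lemma power_le_exp_fact: "(real n) ^ n \<le> exp (real n) * fact n"
proof -
  have "(real n) ^ n /\<^sub>R fact n \<le> exp (real n)"
    using sum_le_suminf[OF sums_summable[OF exp_converges[of "real n"]], of "{n}"]
      sums_unique[OF exp_converges[of "real n"]] by simp
  then show ?thesis by (simp add: field_simps)
qed

text \<open>
  The arithmetic-geometric mean inequality is applied to \<open>k a\<^sub>k\<close> (counting from one) instead of \<open>a\<^sub>k\<close>; the
  weights cost only a factor, because \<open>n! \<ge> (n / e)\<^sup>n\<close>, and make the resulting bound summable over \<open>n\<close>.
\<close>

lemma root_prod_le_mean:
  fixes a :: "nat \<Rightarrow> real"
  assumes "\<And>k. a k \<ge> 0" and n: "n > 0"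
  shows "root n (\<Prod>k<n. a k) \<le> (exp 1 / (real n)\<^sup>2) * (\<Sum>k<n. real (Suc k) * a k)"
proof -
  have "root n (\<Prod>k<n. real (Suc k) * a k) \<le> (\<Sum>k<n. real (Suc k) * a k) / n"
    using arith_geom_mean[of "{..<n}" "\<lambda>k. real (Suc k) * a k"] assms
    by (auto simp: sum_divide_distrib lessThan_empty_iff root_powr_inverse prod_nonneg)
  moreover have "(\<Prod>k<n. real (Suc k) * a k) = fact n * (\<Prod>k<n. a k)"
    by (simp add: prod.distrib fact_prod_Suc atLeast0LessThan)
  moreover have "real n / exp 1 \<le> root n (fact n)"
  proof -
    have "(real n / exp 1) ^ n \<le> fact n"
      using power_le_exp_fact[of n] by (simp add: power_divide field_simps flip: exp_of_nat_mult)
    from real_root_le_mono[OF n this] show ?thesis using n by (simp add: real_root_power_cancel)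
  qed
  ultimately have "real n / exp 1 * root n (\<Prod>k<n. a k) \<le> (\<Sum>k<n. real (Suc k) * a k) / n"
    by (smt (verit, best) assms(1) mult_right_mono n prod_nonneg real_root_ge_zero real_root_mult)
  then show ?thesis using n by (simp add: field_simps power2_eq_square)
qed

text \<open>
  Telescoping with \<open>1 / j\<^sup>2 \<le> 1 / (j - 1) - 1 / j\<close>. The subtracted \<open>1 / n\<close> makes the induction work.
\<close>

lemma sum_inverse_squares_le:
  "k < n \<Longrightarrow> (\<Sum>j=Suc k..n. 1 / (real j)\<^sup>2) \<le> 2 / real (Suc k) - 1 / real n"
proof (induction n)
  case (Suc n)
  show ?case
  proof (cases "k = n")
    case True
    have "1 / (1 + real n)\<^sup>2 \<le> 1 / (1 + real n)"
      by (intro divide_left_mono) (auto simp: power2_eq_square)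
    then show ?thesis using True by (simp add: diff_divide_distrib[symmetric])
  next
    case False
    then have "k < n" "n > 0" using Suc by auto
    have "1 / (real (Suc n))\<^sup>2 \<le> 1 / real n - 1 / real (Suc n)"
    proof -
      have "1 / (real (Suc n))\<^sup>2 \<le> 1 / (real n * real (Suc n))"
        using \<open>n > 0\<close> by (intro divide_left_mono) (auto simp: power2_eq_square)
      also have "\<dots> = 1 / real n - 1 / real (Suc n)" using \<open>n > 0\<close> by (simp add: field_simps)
      finally show ?thesis .
    qed
    then show ?thesis using Suc.IH[OF \<open>k < n\<close>] Suc.prems by simp
  qed
qed simp

text \<open>
  Sum the bound of \<open>root_prod_le_mean\<close> over \<open>n\<close> and exchange the order of summation. The sum of the
  geometric means comes out as at most \<open>2 e\<close> times the sum of \<open>a\<close> (the optimal constant is \<open>e\<close>).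
\<close>

lemma carleman_inequality:
  fixes a :: "nat \<Rightarrow> real"
  assumes nn: "\<And>k. a k \<ge> 0" and sm: "summable a"
  shows "summable (\<lambda>n. root (Suc n) (\<Prod>k\<le>n. a k))"
proof (rule summableI_nonneg_bounded)
  show "root (Suc n) (\<Prod>k\<le>n. a k) \<ge> 0" for n by (simp add: nn prod_nonneg)
  fix L
  have "(\<Sum>n<L. root (Suc n) (\<Prod>k\<le>n. a k))
      \<le> (\<Sum>n<L. \<Sum>k<Suc n. exp 1 / (real (Suc n))\<^sup>2 * (real (Suc k) * a k))"
    using root_prod_le_mean[of a "Suc _", OF nn] by (intro sum_mono) (simp add: lessThan_Suc_atMost sum_distrib_left)
  also have "\<dots> = (\<Sum>n<L. \<Sum>k<L. if k \<le> n then exp 1 / (real (Suc n))\<^sup>2 * (real (Suc k) * a k) else 0)"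
    by (intro sum.cong refl sum.mono_neutral_cong_left) auto
  also have "\<dots> = (\<Sum>k<L. \<Sum>n<L. if k \<le> n then exp 1 / (real (Suc n))\<^sup>2 * (real (Suc k) * a k) else 0)"
    by (rule sum.swap)
  also have "\<dots> \<le> (\<Sum>k<L. 2 * exp 1 * a k)"
  proof (rule sum_mono)
    fix k assume "k \<in> {..<L}"
    then have k: "k < L" by simp
    have "(\<Sum>n<L. if k \<le> n then exp 1 / (real (Suc n))\<^sup>2 * (real (Suc k) * a k) else 0)
      = (\<Sum>n\<in>{k..<L}. exp 1 / (real (Suc n))\<^sup>2 * (real (Suc k) * a k))"
      by (intro sum.mono_neutral_cong_right) auto
    also have "\<dots> = exp 1 * (real (Suc k) * a k) * (\<Sum>n\<in>{k..<L}. 1 / (real (Suc n))\<^sup>2)"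
      by (simp add: sum_distrib_left)
    also have "(\<Sum>n\<in>{k..<L}. 1 / (real (Suc n))\<^sup>2) = (\<Sum>j=Suc k..L. 1 / (real j)\<^sup>2)"
      by (rule sum.reindex_bij_witness[of _ "\<lambda>j. j - 1" Suc]) auto
    also have "exp 1 * (real (Suc k) * a k) * \<dots> \<le> exp 1 * (real (Suc k) * a k) * (2 / real (Suc k))"
      using sum_inverse_squares_le[OF k] nn[of k] by (intro mult_left_mono) (auto intro: order_trans)
    also have "\<dots> = 2 * exp 1 * a k" by simp
    finally show "(\<Sum>n<L. if k \<le> n then exp 1 / (real (Suc n))\<^sup>2 * (real (Suc k) * a k) else 0) \<le> 2 * exp 1 * a k" .
  qed
  also have "\<dots> \<le> 2 * exp 1 * suminf a"
    unfolding sum_distrib_left[symmetric] by (intro mult_left_mono sum_le_suminf sm nn) auto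
  finally show "(\<Sum>n<L. root (Suc n) (\<Prod>k\<le>n. a k)) \<le> 2 * exp 1 * suminf a" .
qed

section \<open>Bang's vanishing lemma\<close>

text \<open>
  Bang's real-variable proof of the Denjoy-Carleman theorem, with \<open>B n x\<close> in the place of the size of the
  \<open>n\<close>-th derivative at \<open>x\<close>. Of a smooth function only the Taylor inequality is kept, so that \<open>B\<close> may be any
  sequence of seminorms of derivatives. The numbers \<open>\<rho> n\<close> are lower bounds for the ratios \<open>M n / M (n + 1)\<close>.

  The quantity \<open>sup\<^sub>n e\<^sup>-\<^sup>n B n x / M n\<close> is the right one to follow. While it is at most \<open>e\<^sup>-\<^sup>k\<^sup>-\<^sup>1\<close>, a step of
  length at most \<open>\<rho> k / e\<close> increases it at most to \<open>e\<^sup>-\<^sup>k\<close>: only the derivatives of order at most \<open>k\<close>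
  have to be examined, and for these the Taylor expansion up to order \<open>k + 1\<close> is dominated by the
  exponential series at \<open>1\<close>. At \<open>0\<close> it is at most any \<open>e\<^sup>-\<^sup>K\<close>, and descending from \<open>K\<close> to
  \<open>k\<close> covers the distance \<open>(\<rho> k + \<dots> + \<rho> (K - 1)) / e\<close>, which becomes arbitrarily large.
\<close>

lemma bang_vanishing:
  fixes B :: "nat \<Rightarrow> real \<Rightarrow> real" and M \<rho> :: "nat \<Rightarrow> real"
  assumes M: "\<And>n. M n > 0" and B_le: "\<And>n x. B n x \<le> M n" and B0: "\<And>n. B n 0 \<le> 0"
    and taylor: "\<And>n d x h. h \<ge> 0 \<Longrightarrow>
       B n (x + h) \<le> (\<Sum>j\<le>d. B (n + j) x * h ^ j / fact j) + M (n + Suc d) * h ^ Suc d / fact (Suc d)"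
    and \<rho>: "\<And>n. \<rho> n > 0" "decseq \<rho>" "\<And>n. M (Suc n) * \<rho> n \<le> M n" "\<not> summable \<rho>"
    and t: "t \<ge> 0"
  shows "B 0 t \<le> 0"
proof -
  \<comment> \<open>\<open>P k x\<close> bounds the supremum by \<open>e\<^sup>-\<^sup>k\<close>\<close>
  define P where "P k x \<longleftrightarrow> (\<forall>n. B n x \<le> exp (real n - real k) * M n)" for k x
  have M_pow: "M (n + j) * \<rho> k ^ j \<le> M n" if "n + j \<le> Suc k" for n j k
    using that
  proof (induction j)
    case (Suc j)
    have "M (n + Suc j) * \<rho> k ^ Suc j = (M (Suc (n + j)) * \<rho> k) * \<rho> k ^ j" by simp
    also have "\<dots> \<le> (M (Suc (n + j)) * \<rho> (n + j)) * \<rho> k ^ j"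
      using decseqD[OF \<rho>(2), of "n + j" k] Suc.prems M \<rho>(1)
      by (intro mult_right_mono mult_left_mono) (auto simp: less_imp_le)
    also have "\<dots> \<le> M (n + j) * \<rho> k ^ j"
      using \<rho> by (intro mult_right_mono) (auto simp: less_imp_le)
    also have "\<dots> \<le> M n" using Suc by simp
    finally show ?case .
  qed simp
  have step: "P k (x + h)" if P: "P (Suc k) x" and h: "0 \<le> h" "h \<le> \<rho> k / exp 1" for k x h
    unfolding P_def
  proof
    fix n
    show "B n (x + h) \<le> exp (real n - real k) * M n"
    proof (cases "n \<ge> Suc k")
      case True
      \<comment> \<open>high orders: the a priori bound is already below the claim\<close>
      then have "1 \<le> exp (real n - real k)" by simp
      then have "M n \<le> exp (real n - real k) * M n" using M[of n] by simp
      then show ?thesis using B_le[of n "x + h"] by linarith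
    next
      case False
      define d where "d = k - n"
      have d: "n + Suc d = Suc k" using False by (simp add: d_def)
      define E where "E = exp (real n - real (Suc k)) * M n"
      have E: "E > 0" using M by (simp add: E_def)
      have pw: "M (n + j) * h ^ j \<le> exp (- real j) * M n" if "j \<le> Suc d" for j
      proof -
        have "M (n + j) * h ^ j \<le> M (n + j) * (\<rho> k / exp 1) ^ j"
          using h M by (intro mult_left_mono power_mono) (auto simp: less_imp_le)
        also have "\<dots> = (M (n + j) * \<rho> k ^ j) * exp (- real j)"
          by (simp add: power_divide exp_minus field_simps flip: exp_of_nat_mult)
        also have "\<dots> \<le> M n * exp (- real j)"
          using M_pow[of n j k] that d by (intro mult_right_mono) auto
        finally show ?thesis by (simp add: mult.commute)
      qed
      have "B n (x + h) \<le> (\<Sum>j\<le>d. B (n + j) x * h ^ j / fact j) + M (n + Suc d) * h ^ Suc d / fact (Suc d)"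
        by (rule taylor[OF h(1)])
      also have "\<dots> \<le> (\<Sum>j\<le>d. E / fact j) + E / fact (Suc d)"
      proof (intro add_mono sum_mono divide_right_mono)
        fix j assume "j \<in> {..d}"
        have "B (n + j) x * h ^ j \<le> (exp (real (n + j) - real (Suc k)) * M (n + j)) * h ^ j"
          using P[unfolded P_def, rule_format, of "n + j"] h(1) by (intro mult_right_mono) auto
        also have "\<dots> \<le> exp (real (n + j) - real (Suc k)) * (exp (- real j) * M n)"
          using pw[of j] \<open>j \<in> {..d}\<close> by (simp add: mult.assoc)
        also have "\<dots> = E" by (simp add: E_def mult.assoc[symmetric] exp_add[symmetric])
        finally show "B (n + j) x * h ^ j \<le> E" .
      next
        have "real n - real (Suc k) = - real (Suc d)" using d by linarith
        then show "M (n + Suc d) * h ^ Suc d \<le> E"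
          using pw[of "Suc d"] unfolding E_def by (simp only: order_refl)
      qed auto
      also have "\<dots> = E * (\<Sum>j\<le>Suc d. inverse (fact j))"
        by (simp add: sum_distrib_left divide_inverse distrib_left)
      also have "\<dots> \<le> E * exp 1"
        using sum_le_suminf[OF sums_summable[OF exp_converges[of "1::real"]], of "{..Suc d}"]
          sums_unique[OF exp_converges[of "1::real"]] E by (intro mult_left_mono) auto
      also have "\<dots> = exp (real n - real k) * M n"
        by (simp add: E_def exp_add[symmetric] mult.commute mult.left_commute flip: exp_add)
      finally show ?thesis .
    qed
  qed
  have reach: "P k x" if "0 \<le> x" "x \<le> (\<Sum>i=k..<k+d. \<rho> i) / exp 1" for k d x
    using that
  proof (induction d arbitrary: k x)
    case 0
    then have "x = 0" by simp
    show ?case unfolding P_def \<open>x = 0\<close>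
    proof
      fix n show "B n 0 \<le> exp (real n - real k) * M n"
        using B0[of n] M[of n] by (meson exp_ge_zero less_imp_le mult_nonneg_nonneg order_trans)
    qed
  next
    case (Suc d)
    define h where "h = min x (\<rho> k / exp 1)"
    have "(\<Sum>i=k..<k + Suc d. \<rho> i) = \<rho> k + (\<Sum>i=Suc k..<Suc k+d. \<rho> i)"
      by (subst sum.atLeast_Suc_lessThan) auto
    then have "x \<le> \<rho> k / exp 1 + (\<Sum>i=Suc k..<Suc k+d. \<rho> i) / exp 1"
      using Suc.prems(2) by (simp only: add_divide_distrib)
    moreover have "(\<Sum>i=Suc k..<Suc k+d. \<rho> i) / exp 1 \<ge> 0"
      using \<rho>(1) by (intro divide_nonneg_nonneg sum_nonneg) (auto intro: less_imp_le)
    ultimately have "x - h \<le> (\<Sum>i=Suc k..<Suc k+d. \<rho> i) / exp 1"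
      unfolding h_def by linarith
    then have "P (Suc k) (x - h)" using Suc.prems by (intro Suc.IH) (auto simp: h_def)
    from step[OF this, of h] show ?case using Suc.prems \<rho>(1)[of k] by (auto simp: h_def)
  qed
  have "P k t" for k
  proof -
    have "\<not> summable (\<lambda>i. \<rho> (i + k))" using \<rho>(4) by (simp add: summable_iff_shift)
    then obtain d where "(\<Sum>i<d. \<rho> (i + k)) > exp 1 * t"
      using summableI_nonneg_bounded[of "\<lambda>i. \<rho> (i + k)" "exp 1 * t"] \<rho>(1) by (meson less_imp_le not_le)
    moreover have "(\<Sum>i<d. \<rho> (i + k)) = (\<Sum>i=k..<k+d. \<rho> i)"
      using sum.shift_bounds_nat_ivl[of \<rho> 0 k d] by (simp add: atLeast0LessThan add.commute)
    ultimately show ?thesis using t by (intro reach[of t k d]) (auto simp: field_simps)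
  qed
  then have le: "B 0 t \<le> exp (- real k) * M 0" for k unfolding P_def by (metis diff_0 of_nat_0)
  have "(\<lambda>k. exp (- real k) * M 0) \<longlonglongrightarrow> 0 * M 0"
    by (intro tendsto_mult tendsto_const filterlim_compose[OF exp_at_bot]
        filterlim_compose[OF filterlim_uminus_at_bot_at_top] filterlim_real_sequentially)
  then show ?thesis using le by (intro LIMSEQ_le_const[of _ 0]) auto
qed

section \<open>Quadratic means and coordinatewise sines\<close>

text \<open>
  A bounded substitute for the vector \<open>t y\<close>, applied coordinate by coordinate.
\<close>

definition sin_map :: "real \<Rightarrow> 'a::euclidean_space \<Rightarrow> 'a" where
  "sin_map t y = (\<Sum>b\<in>Basis. sin (t * (y \<bullet> b)) *\<^sub>R b)"

lemma sin_map_inner: "b \<in> Basis \<Longrightarrow> sin_map t y \<bullet> b = sin (t * (y \<bullet> b))"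
  by (simp add: sin_map_def)

text \<open>
  As \<open>t\<close> tends to zero, \<open>sin (t a) / t\<close> tends to \<open>a\<close>, the derivative of \<open>sin (x a)\<close> at \<open>x = 0\<close>.
\<close>

lemma sin_map_scaled_limit:
  fixes y :: "'a::euclidean_space"
  shows "(\<lambda>n. real (Suc n) *\<^sub>R sin_map (1 / real (Suc n)) y) \<longlonglongrightarrow> y"
proof -
  have lim: "(\<lambda>n. real (Suc n) * sin (1 / real (Suc n) * a)) \<longlonglongrightarrow> a" for a :: real
  proof -
    have "((\<lambda>x. sin (x * a)) has_real_derivative a) (at 0)"
      by (auto intro!: derivative_eq_intros)
    then have "((\<lambda>x. sin (x * a) / x) \<longlongrightarrow> a) (at 0)" by (simp add: DERIV_def)
    then have "(\<lambda>n. sin ((1 / real (Suc n)) * a) / (1 / real (Suc n))) \<longlonglongrightarrow> a"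
    proof (rule filterlim_compose)
      show "filterlim (\<lambda>n. 1 / real (Suc n)) (at 0) sequentially"
        using LIMSEQ_inverse_real_of_nat by (intro filterlim_atI) (auto simp: inverse_eq_divide)
    qed
    then show ?thesis by (simp add: mult.commute)
  qed
  have "(\<lambda>n. \<Sum>b\<in>Basis. (real (Suc n) * sin (1 / real (Suc n) * (y \<bullet> b))) *\<^sub>R b) \<longlonglongrightarrow> (\<Sum>b\<in>Basis. (y \<bullet> b) *\<^sub>R b)"
    by (intro tendsto_sum tendsto_scaleR lim tendsto_const)
  then show ?thesis by (simp only: sin_map_def scaleR_sum_right scaleR_scaleR euclidean_representation)
qed

text \<open>
  Measures with finite moments of all orders, in the form in which they are used.
\<close>

locale poly_measure =
  fixes \<mu> :: "'a::euclidean_space measure"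
  assumes sets_eq: "sets \<mu> = sets borel"
    and integrable_poly: "real_polynomial_function p \<Longrightarrow> integrable \<mu> p"
begin

lemma measurable_iff [simp]: "borel_measurable \<mu> = borel_measurable borel"
  by (intro measurable_cong_sets sets_eq refl)

lemma poly_measurable: "real_polynomial_function (p :: 'a \<Rightarrow> real) \<Longrightarrow> p \<in> borel_measurable borel"
  by (intro borel_measurable_continuous_onI continuous_on_polymonial_function)
     (simp add: real_polynomial_function_eq)

definition L2 :: "('a \<Rightarrow> 'b::{real_normed_vector, second_countable_topology}) \<Rightarrow> bool" where
  "L2 f \<longleftrightarrow> f \<in> borel_measurable borel \<and> integrable \<mu> (\<lambda>y. (norm (f y))\<^sup>2)"

definition norm2 :: "('a \<Rightarrow> 'b::real_normed_vector) \<Rightarrow> real" where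
  "norm2 f = sqrt (\<integral>y. (norm (f y))\<^sup>2 \<partial>\<mu>)"

lemma norm2_nonneg: "norm2 f \<ge> 0" by (simp add: norm2_def)

lemma norm2_square: "(norm2 f)\<^sup>2 = (\<integral>y. (norm (f y))\<^sup>2 \<partial>\<mu>)"
  by (simp add: norm2_def)

lemma L2_poly: "real_polynomial_function (p :: 'a \<Rightarrow> real) \<Longrightarrow> L2 p"
  unfolding L2_def by (auto simp: poly_measurable intro!: integrable_poly)

lemma L2_mono:
  assumes "L2 g" "f \<in> borel_measurable borel" "\<And>y. norm (f y) \<le> norm (g y)"
  shows "L2 f" "norm2 f \<le> norm2 g"
proof -
  show *: "L2 f" unfolding L2_def
  proof
    show "integrable \<mu> (\<lambda>y. (norm (f y))\<^sup>2)"
      by (rule Bochner_Integration.integrable_bound[where f = "\<lambda>y. (norm (g y))\<^sup>2"])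
         (use assms in \<open>auto simp: L2_def intro!: power_mono\<close>)
  qed fact
  show "norm2 f \<le> norm2 g" unfolding norm2_def
    using assms * by (intro real_sqrt_le_mono integral_mono) (auto simp: L2_def intro!: power_mono)
qed

text \<open>
  The polynomial \<open>s\<^sup>2 A - 2 s X + B\<close> in \<open>s\<close>, with \<open>A\<close>, \<open>B\<close> the integrals of the squares and \<open>X\<close> the integral
  of the absolute product, is nonnegative.
\<close>

lemma cauchy_schwarz:
  fixes f g :: "'a \<Rightarrow> real"
  assumes "L2 f" "L2 g"
  shows "integrable \<mu> (\<lambda>y. f y * g y)" "(\<integral>y. \<bar>f y * g y\<bar> \<partial>\<mu>) \<le> norm2 f * norm2 g"
proof -
  have f: "integrable \<mu> (\<lambda>y. (f y)\<^sup>2)" "f \<in> borel_measurable borel"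
    and g: "integrable \<mu> (\<lambda>y. (g y)\<^sup>2)" "g \<in> borel_measurable borel"
    using assms by (auto simp: L2_def)
  show *: "integrable \<mu> (\<lambda>y. f y * g y)"
  proof (rule Bochner_Integration.integrable_bound[where f = "\<lambda>y. (f y)\<^sup>2 + (g y)\<^sup>2"])
    have "\<bar>u * v\<bar> \<le> u\<^sup>2 + v\<^sup>2" for u v :: real
      using sum_squares_bound[of "\<bar>u\<bar>" "\<bar>v\<bar>"] mult_nonneg_nonneg[OF abs_ge_zero[of u] abs_ge_zero[of v]]
      unfolding abs_mult power2_abs by linarith
    then show "AE y in \<mu>. norm (f y * g y) \<le> norm ((f y)\<^sup>2 + (g y)\<^sup>2)" by auto
  qed (use f g in auto)
  define A B X where "A = (\<integral>y. (f y)\<^sup>2 \<partial>\<mu>)" and "B = (\<integral>y. (g y)\<^sup>2 \<partial>\<mu>)" and "X = (\<integral>y. \<bar>f y * g y\<bar> \<partial>\<mu>)"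
  have nn: "A \<ge> 0" "B \<ge> 0" "X \<ge> 0" by (auto simp: A_def B_def X_def)
  have quad: "2 * s * X \<le> s\<^sup>2 * A + B" for s
  proof -
    have "2 * s * X = (\<integral>y. 2 * s * \<bar>f y * g y\<bar> \<partial>\<mu>)" unfolding X_def by simp
    also have "\<dots> \<le> (\<integral>y. s\<^sup>2 * (f y)\<^sup>2 + (g y)\<^sup>2 \<partial>\<mu>)"
    proof (rule integral_mono)
      fix y show "2 * s * \<bar>f y * g y\<bar> \<le> s\<^sup>2 * (f y)\<^sup>2 + (g y)\<^sup>2"
        using sum_squares_bound[of "s * \<bar>f y\<bar>" "\<bar>g y\<bar>"] by (simp add: abs_mult power_mult_distrib)
    qed (use * f g in auto)
    also have "\<dots> = s\<^sup>2 * A + B" using f g by (simp add: A_def B_def)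
    finally show ?thesis .
  qed
  have "X\<^sup>2 \<le> A * B"
  proof (cases "A = 0")
    case True
    \<comment> \<open>a nonnegative polynomial of degree at most one is constant\<close>
    have "X = 0"
    proof (rule ccontr)
      assume "X \<noteq> 0"
      then show False using quad[of "(B + 1) / X"] nn True by simp
    qed
    then show ?thesis using True by simp
  next
    case False
    then show ?thesis using quad[of "X / A"] nn by (simp add: field_simps power2_eq_square)
  qed
  then have "X \<le> sqrt (A * B)" by (rule real_le_rsqrt)
  then show "(\<integral>y. \<bar>f y * g y\<bar> \<partial>\<mu>) \<le> norm2 f * norm2 g"
    by (simp add: norm2_def A_def B_def X_def real_sqrt_mult)
qed

lemma L2_norm: "L2 f \<Longrightarrow> L2 (\<lambda>y. norm (f y))"
  unfolding L2_def by auto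

lemma
  assumes f: "L2 f" and g: "L2 g"
  shows L2_add: "L2 (\<lambda>y. f y + g y)" and norm2_add: "norm2 (\<lambda>y. f y + g y) \<le> norm2 f + norm2 g"
proof -
  let ?s = "\<lambda>y. (norm (f y))\<^sup>2 + 2 * (norm (f y) * norm (g y)) + (norm (g y))\<^sup>2"
  note cs = cauchy_schwarz[OF L2_norm[OF f] L2_norm[OF g]]
  have int: "integrable \<mu> ?s"
    using f g cs(1) by (auto simp: L2_def)
  have le: "(norm (f y + g y))\<^sup>2 \<le> ?s y" for y
    using power_mono[OF norm_triangle_ineq[of "f y" "g y"], of 2] by (simp add: power2_sum algebra_simps)
  have meas: "(\<lambda>y. f y + g y) \<in> borel_measurable borel" using f g by (auto simp: L2_def)
  then show *: "L2 (\<lambda>y. f y + g y)" unfolding L2_def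
    using le int
    by (auto intro!: Bochner_Integration.integrable_bound[OF int])
  have "(norm2 (\<lambda>y. f y + g y))\<^sup>2 \<le> (\<integral>y. ?s y \<partial>\<mu>)"
    unfolding norm2_square using le int * by (intro integral_mono) (auto simp: L2_def)
  also have "\<dots> = (norm2 f)\<^sup>2 + 2 * (\<integral>y. norm (f y) * norm (g y) \<partial>\<mu>) + (norm2 g)\<^sup>2"
    using f g cs(1) by (auto simp: L2_def norm2_square)
  also have "\<dots> \<le> (norm2 f)\<^sup>2 + 2 * (norm2 f * norm2 g) + (norm2 g)\<^sup>2"
    using cs(2) by (simp add: norm2_def)
  also have "\<dots> = (norm2 f + norm2 g)\<^sup>2" by (simp add: power2_sum algebra_simps)
  finally show "norm2 (\<lambda>y. f y + g y) \<le> norm2 f + norm2 g"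
    using norm2_nonneg by (meson add_nonneg_nonneg power2_le_imp_le)
qed

lemma
  assumes "L2 f"
  shows L2_cmult: "L2 (\<lambda>y. c * f y :: 'b::{real_normed_div_algebra, second_countable_topology})"
    and norm2_cmult: "norm2 (\<lambda>y. c * f y) = norm c * norm2 f"
  using assms by (auto simp: L2_def norm2_def norm_mult power_mult_distrib real_sqrt_mult)

lemma L2_diff:
  fixes f g :: "'a \<Rightarrow> 'b::{real_normed_div_algebra, second_countable_topology}"
  assumes "L2 f" "L2 g" shows "L2 (\<lambda>y. f y - g y)"
  using L2_add[OF assms(1) L2_cmult[OF assms(2), of "-1"]] by simp

lemma L2_bounded_mult:
  fixes E f :: "'a \<Rightarrow> real"
  assumes "L2 f" "E \<in> borel_measurable borel" "\<And>y. \<bar>E y\<bar> \<le> c"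
  shows "L2 (\<lambda>y. E y * f y)" "norm2 (\<lambda>y. E y * f y) \<le> c * norm2 f"
proof -
  have c: "c \<ge> 0" using assms(3)[of undefined] by linarith
  have *: "norm (E y * f y) \<le> norm (c * f y)" for y
    using assms(3)[of y] c by (simp add: abs_mult mult_right_mono)
  have m: "(\<lambda>y. E y * f y) \<in> borel_measurable borel" using assms by (auto simp: L2_def)
  show "L2 (\<lambda>y. E y * f y)" "norm2 (\<lambda>y. E y * f y) \<le> c * norm2 f"
    using L2_mono[OF L2_cmult[OF assms(1), of c] m *] norm2_cmult[OF assms(1), of c] c by auto
qed

text \<open>
  The seminorm of \<open>L\<^sup>2\<close> modulo the polynomials. It turns the vanishing of derivatives modulo the
  polynomials into plain vanishing.
\<close>

definition poly_dist :: "('a \<Rightarrow> complex) \<Rightarrow> real" where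
  "poly_dist f = Inf {norm2 (\<lambda>y. f y - p y) | p. polynomial_function p}"

lemma poly_dist_le: "polynomial_function p \<Longrightarrow> poly_dist f \<le> norm2 (\<lambda>y. f y - p y)"
  unfolding poly_dist_def by (intro cInf_lower bdd_belowI[of _ 0]) (auto intro: norm2_nonneg)

lemma poly_dist_le_norm2: "poly_dist f \<le> norm2 f"
  using poly_dist_le[of "\<lambda>_. 0" f] by simp

lemma poly_dist_poly: "polynomial_function f \<Longrightarrow> poly_dist f \<le> 0"
  using poly_dist_le[of f f] by (simp add: norm2_def)

lemma poly_dist_less:
  assumes "poly_dist f < c"
  obtains p where "polynomial_function p" "norm2 (\<lambda>y. f y - p y) < c"
proof -
  have "{norm2 (\<lambda>y. f y - p y) | p. polynomial_function p} \<noteq> {}"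
    using polynomial_function_const by blast
  from cInf_lessD[OF this assms[unfolded poly_dist_def]] show ?thesis using that by auto
qed

lemma complex_polynomial_iff:
  "polynomial_function (p :: 'a \<Rightarrow> complex) \<longleftrightarrow>
    real_polynomial_function (\<lambda>y. Re (p y)) \<and> real_polynomial_function (\<lambda>y. Im (p y))"
  by (simp add: polynomial_function_iff_Basis_inner Basis_complex_def)

lemma L2_complex_poly:
  assumes "polynomial_function (p :: 'a \<Rightarrow> complex)" shows "L2 p"
  unfolding L2_def
proof
  show "p \<in> borel_measurable borel"
    by (intro borel_measurable_continuous_onI continuous_on_polymonial_function assms)
  show "integrable \<mu> (\<lambda>y. (norm (p y))\<^sup>2)" unfolding cmod_power2
    using assms by (intro integrable_poly poly_intros) (auto simp: complex_polynomial_iff)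
qed

lemma polynomial_function_cmult:
  assumes "polynomial_function (p :: 'a \<Rightarrow> complex)" shows "polynomial_function (\<lambda>y. c * p y)"
  using assms unfolding complex_polynomial_iff by (auto intro!: poly_intros)

lemma poly_dist_add:
  assumes f: "L2 f" and g: "L2 g"
  shows "poly_dist (\<lambda>y. f y + g y) \<le> poly_dist f + poly_dist g"
proof (rule field_le_epsilon)
  fix e :: real assume "e > 0"
  obtain p where p: "polynomial_function p" "norm2 (\<lambda>y. f y - p y) < poly_dist f + e / 2"
    using poly_dist_less[of f "poly_dist f + e / 2"] \<open>e > 0\<close> by auto
  obtain q where q: "polynomial_function q" "norm2 (\<lambda>y. g y - q y) < poly_dist g + e / 2"
    using poly_dist_less[of g "poly_dist g + e / 2"] \<open>e > 0\<close> by auto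
  have "poly_dist (\<lambda>y. f y + g y) \<le> norm2 (\<lambda>y. (f y + g y) - (p y + q y))"
    using p q by (intro poly_dist_le polynomial_function_add)
  also have "\<dots> = norm2 (\<lambda>y. (f y - p y) + (g y - q y))" by (simp add: algebra_simps)
  also have "\<dots> \<le> norm2 (\<lambda>y. f y - p y) + norm2 (\<lambda>y. g y - q y)"
    by (intro norm2_add L2_diff L2_complex_poly p(1) q(1) f g)
  finally show "poly_dist (\<lambda>y. f y + g y) \<le> poly_dist f + poly_dist g + e" using p q by linarith
qed

lemma poly_dist_cmult:
  assumes f: "L2 f"
  shows "poly_dist (\<lambda>y. c * f y) \<le> norm c * poly_dist f"
proof (rule field_le_epsilon)
  fix e :: real assume "e > 0"
  define e' where "e' = e / (norm c + 1)"
  have "norm c + 1 > 0" using norm_ge_zero[of c] by linarith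
  then have e': "e' > 0" "norm c * e' \<le> e"
    using \<open>e > 0\<close> by (auto simp: e'_def field_simps)
  obtain p where p: "polynomial_function p" "norm2 (\<lambda>y. f y - p y) < poly_dist f + e'"
    using poly_dist_less[of f "poly_dist f + e'"] e' by auto
  have "poly_dist (\<lambda>y. c * f y) \<le> norm2 (\<lambda>y. c * f y - c * p y)"
    using p by (intro poly_dist_le polynomial_function_cmult)
  also have "\<dots> = norm c * norm2 (\<lambda>y. f y - p y)"
    using norm2_cmult[OF L2_diff[OF f L2_complex_poly[OF p(1)]], of c] by (simp add: algebra_simps)
  also have "\<dots> \<le> norm c * (poly_dist f + e')" using p(2) by (intro mult_left_mono) auto
  also have "\<dots> \<le> norm c * poly_dist f + e" using e'(2) by (simp add: algebra_simps)
  finally show "poly_dist (\<lambda>y. c * f y) \<le> norm c * poly_dist f + e" .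
qed

lemma L2_zero: "L2 (\<lambda>_. 0 :: 'b::{real_normed_vector, second_countable_topology})"
  by (simp add: L2_def)

lemma
  assumes "finite I" "\<And>i. i \<in> I \<Longrightarrow> L2 (f i)"
  shows L2_sum: "L2 (\<lambda>y. \<Sum>i\<in>I. f i y)"
    and poly_dist_sum: "poly_dist (\<lambda>y. \<Sum>i\<in>I. f i y) \<le> (\<Sum>i\<in>I. poly_dist (f i))"
proof -
  have "L2 (\<lambda>y. \<Sum>i\<in>I. f i y) \<and> poly_dist (\<lambda>y. \<Sum>i\<in>I. f i y) \<le> (\<Sum>i\<in>I. poly_dist (f i))"
    using assms
  proof (induction)
    case (insert i I)
    then have *: "L2 (f i)" "L2 (\<lambda>y. \<Sum>i\<in>I. f i y)" by auto
    show ?case using L2_add[OF *] poly_dist_add[OF *] insert by auto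
  qed (use poly_dist_poly[of "\<lambda>_. 0"] L2_zero in auto)
  then show "L2 (\<lambda>y. \<Sum>i\<in>I. f i y)" "poly_dist (\<lambda>y. \<Sum>i\<in>I. f i y) \<le> (\<Sum>i\<in>I. poly_dist (f i))" by auto
qed

text \<open>
  Up to the factor \<open>\<i>\<^sup>n\<close>, the \<open>n\<close>-th derivative in \<open>x\<close> of \<open>cis (x (y \<bullet> b)) q(y)\<close>. At \<open>x = 0\<close> it is a
  polynomial in \<open>y\<close>, and its absolute value does not depend on \<open>x\<close>.
\<close>

definition wave :: "'a \<Rightarrow> ('a \<Rightarrow> real) \<Rightarrow> nat \<Rightarrow> real \<Rightarrow> 'a \<Rightarrow> complex" where
  "wave b q n x y = of_real ((y \<bullet> b) ^ n * q y) * cis (x * (y \<bullet> b))"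

context
  fixes b :: 'a and q :: "'a \<Rightarrow> real"
  assumes q: "real_polynomial_function q"
begin

lemma mono_poly: "real_polynomial_function (\<lambda>y. (y \<bullet> b) ^ n * q y)"
  by (intro poly_intros poly_inner q)

lemma wave_measurable: "wave b q n x \<in> borel_measurable borel"
proof -
  have "continuous_on UNIV (\<lambda>y. (y \<bullet> b) ^ n * q y)"
    using mono_poly by (intro continuous_on_polymonial_function) (simp add: real_polynomial_function_eq)
  then have "continuous_on UNIV (\<lambda>y. complex_of_real ((y \<bullet> b) ^ n * q y))"
    by (rule continuous_on_of_real)
  then show ?thesis unfolding wave_def
    by (intro borel_measurable_continuous_onI continuous_on_mult[OF _ continuous_on_cis]) (auto intro!: continuous_intros)
qed

lemma norm_wave: "norm (wave b q n x y) = norm ((y \<bullet> b) ^ n * q y)"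
  by (simp add: wave_def norm_mult norm_power abs_mult power_abs)

lemma wave_L2: "L2 (wave b q n x)"
  by (rule L2_mono(1)[OF L2_poly[OF mono_poly[of n]] wave_measurable]) (simp only: norm_wave order_refl)

lemma wave_zero: "polynomial_function (wave b q n 0)"
proof -
  have "Re (wave b q n 0 y) = (y \<bullet> b) ^ n * q y" "Im (wave b q n 0 y) = 0" for y
    by (simp_all add: wave_def flip: of_real_power of_real_mult)
  then show ?thesis unfolding complex_polynomial_iff by (simp only: mono_poly real_polynomial_function.intros(2) simp_thms)
qed

lemma wave_norm2: "norm2 (wave b q n x) = norm2 (\<lambda>y. (y \<bullet> b) ^ n * q y)"
  by (simp only: norm2_def norm_wave)

text \<open>
  Taylor's inequality for the distance. The expansion is that of the exponential function, carried
  out pointwise in \<open>y\<close>; the terms of the expansion are the waves of higher order.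
\<close>

lemma wave_taylor:
  assumes "h \<ge> 0"
  shows "poly_dist (wave b q n (x + h)) \<le>
    (\<Sum>j\<le>d. poly_dist (wave b q (n + j) x) * h ^ j / fact j)
      + norm2 (\<lambda>y. (y \<bullet> b) ^ (n + Suc d) * q y) * h ^ Suc d / fact (Suc d)"
proof -
  define T where "T j y = ((\<i> * of_real h) ^ j / fact j) * wave b q (n + j) x y" for j y
  define R where "R y = wave b q (n + 0) (x + h) y + (- 1) * (\<Sum>j\<le>d. T j y)" for y
  have T: "L2 (T j)" for j unfolding T_def by (intro L2_cmult wave_L2)
  have ST: "L2 (\<lambda>y. \<Sum>j\<le>d. T j y)" by (intro L2_sum T) auto
  have R: "L2 R" unfolding R_def by (intro L2_add wave_L2 L2_cmult ST)
  have R_le: "norm (R y) \<le> norm (h ^ Suc d / fact (Suc d) * ((y \<bullet> b) ^ (n + Suc d) * q y))" for y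
  proof -
    have "(\<Sum>j\<le>d. T j y) = wave b q n x y * (\<Sum>j\<le>d. (\<i> * of_real (h * (y \<bullet> b))) ^ j / fact j)"
      by (simp add: T_def wave_def sum_distrib_left power_mult_distrib power_add field_simps)
    moreover have "wave b q n (x + h) y = wave b q n x y * iexp (h * (y \<bullet> b))"
      by (simp add: wave_def cis_conv_exp distrib_right distrib_left exp_add)
    ultimately have R_eq: "R y = wave b q n x y * (iexp (h * (y \<bullet> b)) - (\<Sum>j\<le>d. (\<i> * of_real (h * (y \<bullet> b))) ^ j / fact j))"
      unfolding R_def by (simp only: right_diff_distrib add_0_right mult_minus1) simp
    have "norm (R y) = \<bar>(y \<bullet> b) ^ n * q y\<bar> * norm (iexp (h * (y \<bullet> b)) - (\<Sum>j\<le>d. (\<i> * of_real (h * (y \<bullet> b))) ^ j / fact j))"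
      unfolding R_eq norm_mult norm_wave by (simp add: abs_mult)
    also have "\<dots> \<le> \<bar>(y \<bullet> b) ^ n * q y\<bar> * (\<bar>h * (y \<bullet> b)\<bar> ^ Suc d / fact (Suc d))"
      using iexp_approx1[of "h * (y \<bullet> b)" d] by (intro mult_left_mono) auto
    also have "\<dots> = norm (h ^ Suc d / fact (Suc d) * ((y \<bullet> b) ^ (n + Suc d) * q y))"
      using assms by (simp add: abs_mult power_mult_distrib power_add power_abs)
    finally show ?thesis .
  qed
  have "norm2 R \<le> norm2 (\<lambda>y. h ^ Suc d / fact (Suc d) * ((y \<bullet> b) ^ (n + Suc d) * q y))"
    using R by (intro L2_mono(2)[OF L2_cmult[OF L2_poly[OF mono_poly]] _ R_le]) (simp add: L2_def)
  also have "\<dots> = norm2 (\<lambda>y. (y \<bullet> b) ^ (n + Suc d) * q y) * h ^ Suc d / fact (Suc d)"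
    using assms by (subst norm2_cmult[OF L2_poly[OF mono_poly]]) (simp add: abs_mult power_abs)
  finally have R2: "poly_dist R \<le> \<dots>" using poly_dist_le_norm2 order_trans by blast
  have "poly_dist (wave b q n (x + h)) = poly_dist (\<lambda>y. (\<Sum>j\<le>d. T j y) + R y)"
    by (simp add: R_def)
  also have "\<dots> \<le> poly_dist (\<lambda>y. \<Sum>j\<le>d. T j y) + poly_dist R" by (intro poly_dist_add ST R)
  also have "poly_dist (\<lambda>y. \<Sum>j\<le>d. T j y) \<le> (\<Sum>j\<le>d. poly_dist (T j))" by (intro poly_dist_sum T) auto
  also have "\<dots> \<le> (\<Sum>j\<le>d. poly_dist (wave b q (n + j) x) * h ^ j / fact j)"
  proof (rule sum_mono)
    fix j
    have "poly_dist (T j) \<le> norm ((\<i> * of_real h) ^ j / fact j) * poly_dist (wave b q (n + j) x)"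
      unfolding T_def by (intro poly_dist_cmult wave_L2)
    also have "norm ((\<i> * of_real h) ^ j / fact j) = h ^ j / fact j"
      using assms by (simp add: norm_divide norm_power norm_mult)
    finally show "poly_dist (T j) \<le> poly_dist (wave b q (n + j) x) * h ^ j / fact j" by (simp add: mult.commute)
  qed
  finally show ?thesis using R2 by linarith
qed

text \<open>
  Bang's lemma makes the distance of the wave from the polynomials vanish; the imaginary part of an
  approximating complex polynomial then approximates the sine.
\<close>

lemma sin_approx:
  assumes M: "\<And>n. M n > 0" and M_ge: "\<And>n. norm2 (\<lambda>y. (y \<bullet> b) ^ n * q y) \<le> M n"
    and \<rho>: "\<And>n. \<rho> n > 0" "decseq \<rho>" "\<And>n. M (Suc n) * \<rho> n \<le> M n" "\<not> summable \<rho>"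
    and t: "t \<ge> 0" and e: "e > 0"
  obtains p where "real_polynomial_function p" "norm2 (\<lambda>y. sin (t * (y \<bullet> b)) * q y - p y) < e"
proof -
  have "poly_dist (wave b q 0 t) \<le> 0"
  proof (rule bang_vanishing[where B = "\<lambda>n x. poly_dist (wave b q n x)" and M = M and \<rho> = \<rho>])
    show "poly_dist (wave b q n x) \<le> M n" for n x
      using poly_dist_le_norm2[of "wave b q n x"] M_ge[of n] by (simp add: wave_norm2)
    show "poly_dist (wave b q n 0) \<le> 0" for n by (intro poly_dist_poly wave_zero)
    show "poly_dist (wave b q n (x + h)) \<le> (\<Sum>j\<le>d. poly_dist (wave b q (n + j) x) * h ^ j / fact j)
        + M (n + Suc d) * h ^ Suc d / fact (Suc d)" if "h \<ge> 0" for n d x h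
    proof -
      have "norm2 (\<lambda>y. (y \<bullet> b) ^ (n + Suc d) * q y) * h ^ Suc d / fact (Suc d)
          \<le> M (n + Suc d) * h ^ Suc d / fact (Suc d)"
        using that by (intro divide_right_mono mult_right_mono M_ge) auto
      then show ?thesis using wave_taylor[OF that, of n x d] by linarith
    qed
  qed (use assms in auto)
  then obtain p where p: "polynomial_function p" "norm2 (\<lambda>y. wave b q 0 t y - p y) < e"
    using poly_dist_less[of "wave b q 0 t" e] e by force
  have L: "L2 (\<lambda>y. wave b q 0 t y - p y)" by (intro L2_diff wave_L2 L2_complex_poly p)
  have Im: "sin (t * (y \<bullet> b)) * q y - Im (p y) = Im (wave b q 0 t y - p y)" for y
    by (simp add: wave_def)
  have "norm2 (\<lambda>y. Im (wave b q 0 t y - p y)) \<le> norm2 (\<lambda>y. wave b q 0 t y - p y)"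
  proof (rule L2_mono(2)[OF L])
    have "(\<lambda>y. wave b q 0 t y - p y) \<in> borel_measurable borel" using L by (simp add: L2_def)
    then show "(\<lambda>y. Im (wave b q 0 t y - p y)) \<in> borel_measurable borel"
      by (rule measurable_compose[OF _ borel_measurable_Im])
  qed (simp only: real_norm_def abs_Im_le_cmod)
  then show ?thesis using p that[of "\<lambda>y. Im (p y)"] unfolding Im complex_polynomial_iff by auto
qed

end

section \<open>Bounded multipliers of the closure of the polynomials\<close>

text \<open>
  Bounded functions that map polynomials, and hence the whole quadratic-mean closure of the
  polynomials, into that closure. Boundedness is what makes these functions an algebra.
\<close>

definition multiplier :: "('a \<Rightarrow> real) \<Rightarrow> bool" where
  "multiplier E \<longleftrightarrow> E \<in> borel_measurable borel \<and> (\<exists>c. \<forall>y. \<bar>E y\<bar> \<le> c) \<and>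
     (\<forall>q e. real_polynomial_function q \<longrightarrow> e > 0 \<longrightarrow>
        (\<exists>p. real_polynomial_function p \<and> norm2 (\<lambda>y. E y * q y - p y) < e))"

lemma multiplier_const: "multiplier (\<lambda>_. c)"
  unfolding multiplier_def
proof (intro conjI allI impI)
  fix q :: "'a \<Rightarrow> real" and e :: real assume "real_polynomial_function q" "e > 0"
  then show "\<exists>p. real_polynomial_function p \<and> norm2 (\<lambda>y. c * q y - p y) < e"
    by (intro exI[of _ "\<lambda>y. c * q y"] conjI poly_intros) (auto simp: norm2_def)
qed auto

lemma multiplier_add:
  assumes "multiplier E" "multiplier F" shows "multiplier (\<lambda>y. E y + F y)"
  unfolding multiplier_def
proof (intro conjI allI impI)
  show "(\<lambda>y. E y + F y) \<in> borel_measurable borel" using assms by (auto simp: multiplier_def)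
  obtain c d where cd: "\<And>y. \<bar>E y\<bar> \<le> c" "\<And>y. \<bar>F y\<bar> \<le> d" using assms unfolding multiplier_def by metis
  then have "\<bar>E y + F y\<bar> \<le> c + d" for y by (meson abs_triangle_ineq add_mono order_trans)
  then show "\<exists>c. \<forall>y. \<bar>E y + F y\<bar> \<le> c" by blast
  fix q :: "'a \<Rightarrow> real" and e :: real assume q: "real_polynomial_function q" and "e > 0"
  then have "e / 2 > 0" by simp
  obtain p where p: "real_polynomial_function p" "norm2 (\<lambda>y. E y * q y - p y) < e / 2"
    using assms q \<open>e / 2 > 0\<close> unfolding multiplier_def by metis
  obtain r where r: "real_polynomial_function r" "norm2 (\<lambda>y. F y * q y - r y) < e / 2"
    using assms q \<open>e / 2 > 0\<close> unfolding multiplier_def by metis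
  have "E \<in> borel_measurable borel" "F \<in> borel_measurable borel" using assms by (auto simp: multiplier_def)
  then have "L2 (\<lambda>y. E y * q y)" "L2 (\<lambda>y. F y * q y)"
    using L2_bounded_mult(1)[OF L2_poly[OF q]] cd by blast+
  then have L: "L2 (\<lambda>y. E y * q y - p y)" "L2 (\<lambda>y. F y * q y - r y)"
    using L2_diff L2_poly p(1) r(1) by blast+
  have "norm2 (\<lambda>y. (E y + F y) * q y - (p y + r y)) = norm2 (\<lambda>y. (E y * q y - p y) + (F y * q y - r y))"
    by (simp add: algebra_simps)
  also have "\<dots> < e" using norm2_add[OF L] p(2) r(2) by simp
  finally show "\<exists>p. real_polynomial_function p \<and> norm2 (\<lambda>y. (E y + F y) * q y - p y) < e"
    using p r by (intro exI[of _ "\<lambda>y. p y + r y"] conjI poly_intros)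
qed

text \<open>
  Approximate \<open>F q\<close> by a polynomial \<open>r\<close>; this error is multiplied by the bounded \<open>E\<close>. Then approximate
  \<open>E r\<close>.
\<close>

lemma multiplier_mult:
  assumes "multiplier E" "multiplier F" shows "multiplier (\<lambda>y. E y * F y)"
  unfolding multiplier_def
proof (intro conjI allI impI)
  have Em: "E \<in> borel_measurable borel" and Fm: "F \<in> borel_measurable borel"
    using assms by (auto simp: multiplier_def)
  then show "(\<lambda>y. E y * F y) \<in> borel_measurable borel" by auto
  obtain c d where cd: "\<And>y. \<bar>E y\<bar> \<le> c" "\<And>y. \<bar>F y\<bar> \<le> d" using assms unfolding multiplier_def by metis
  have "c \<ge> 0" using cd(1)[of undefined] by linarith
  then have "\<bar>E y * F y\<bar> \<le> c * d" for y using cd by (simp add: abs_mult mult_mono)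
  then show "\<exists>c. \<forall>y. \<bar>E y * F y\<bar> \<le> c" by blast
  fix q :: "'a \<Rightarrow> real" and e :: real assume q: "real_polynomial_function q" and "e > 0"
  define e' where "e' = e / (2 * (c + 1))"
  have e': "e' > 0" "c * e' \<le> e / 2" using \<open>c \<ge> 0\<close> \<open>e > 0\<close> by (auto simp: e'_def field_simps)
  obtain r where r: "real_polynomial_function r" "norm2 (\<lambda>y. F y * q y - r y) < e'"
    using assms q e'(1) unfolding multiplier_def by metis
  have "e / 2 > 0" using \<open>e > 0\<close> by simp
  then obtain p where p: "real_polynomial_function p" "norm2 (\<lambda>y. E y * r y - p y) < e / 2"
    using assms(1) r(1) unfolding multiplier_def by metis
  have LF: "L2 (\<lambda>y. F y * q y - r y)" using Fm cd(2) q r by (intro L2_diff L2_bounded_mult(1)[where c=d] L2_poly)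
  note EF = L2_bounded_mult[OF LF Em cd(1)]
  have LE: "L2 (\<lambda>y. E y * r y - p y)" using Em cd(1) p r by (intro L2_diff L2_bounded_mult(1)[where c=c] L2_poly)
  have "norm2 (\<lambda>y. (E y * F y) * q y - p y) = norm2 (\<lambda>y. E y * (F y * q y - r y) + (E y * r y - p y))"
    by (simp add: algebra_simps)
  also have "\<dots> \<le> norm2 (\<lambda>y. E y * (F y * q y - r y)) + norm2 (\<lambda>y. E y * r y - p y)"
    by (intro norm2_add EF LE)
  also have "norm2 (\<lambda>y. E y * (F y * q y - r y)) \<le> c * e'"
    using EF(2) r(2) \<open>c \<ge> 0\<close> by (meson less_imp_le mult_left_mono order_trans)
  finally have "norm2 (\<lambda>y. (E y * F y) * q y - p y) < e" using p(2) e'(2) by linarith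
  then show "\<exists>p. real_polynomial_function p \<and> norm2 (\<lambda>y. (E y * F y) * q y - p y) < e" using p(1) by blast
qed

lemma multiplier_sin_map:
  assumes sin: "\<And>b. b \<in> Basis \<Longrightarrow> multiplier (\<lambda>y. sin (t * (y \<bullet> b)))"
    and P: "real_polynomial_function P"
  shows "multiplier (\<lambda>y. P (sin_map t y))"
  using P
proof induction
  case (linear l)
  have "multiplier (\<lambda>y. \<Sum>b\<in>I. l b * sin (t * (y \<bullet> b)))" if "finite I" "I \<subseteq> Basis" for I
    using that by induction (auto intro!: multiplier_const multiplier_add multiplier_mult[OF multiplier_const] sin)
  from this[of Basis] show ?case
    by (subst linear_as_coordinates[OF linear]) (simp add: sin_map_inner)
qed (auto intro: multiplier_const multiplier_add multiplier_mult)

text \<open>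
  Since \<open>sin_map\<close> takes its values in a cube, a uniform polynomial approximation of \<open>\<Psi>\<close> on that
  cube is uniform in \<open>y\<close> over the whole space, which is what an unbounded support requires.
\<close>

lemma approx_continuous_sin_map:
  assumes sin: "\<And>b. b \<in> Basis \<Longrightarrow> multiplier (\<lambda>y. sin (t * (y \<bullet> b)))"
    and \<Psi>: "continuous_on UNIV (\<Psi> :: 'a \<Rightarrow> real)" and e: "e > 0"
  obtains p where "real_polynomial_function p" "norm2 (\<lambda>y. \<Psi> (sin_map t y) - p y) < e"
    "L2 (\<lambda>y. \<Psi> (sin_map t y))"
proof -
  define c where "c = norm2 (\<lambda>_::'a. 1 :: real)"
  have c: "c \<ge> 0" unfolding c_def by (rule norm2_nonneg)
  define e' where "e' = e / (2 * (c + 1))"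
  have e': "e' > 0" "e' * c \<le> e / 2" using c e by (auto simp: e'_def field_simps)
  let ?K = "cbox (- One) One :: 'a set"
  have K: "sin_map t y \<in> ?K" for y by (auto simp: mem_box sin_map_inner)
  obtain P where P: "real_polynomial_function P" "\<And>u. u \<in> ?K \<Longrightarrow> \<bar>\<Psi> u - P u\<bar> < e'"
    using Stone_Weierstrass_real_polynomial_function[OF compact_cbox continuous_on_subset[OF \<Psi>] e'(1)] by blast
  have mult: "multiplier (\<lambda>y. P (sin_map t y))" by (intro multiplier_sin_map sin P)
  then obtain p where p: "real_polynomial_function p" "norm2 (\<lambda>y. P (sin_map t y) * 1 - p y) < e / 2"
    using e unfolding multiplier_def
    by (elim conjE) (drule spec[of _ "\<lambda>_. 1"], drule spec[of _ "e / 2"], auto intro: real_polynomial_function.intros(2))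
  have "continuous_on UNIV (\<lambda>y. \<Psi> (sin_map t y))"
    unfolding sin_map_def by (intro continuous_on_compose2[OF \<Psi>] continuous_intros) auto
  then have m\<Psi>: "(\<lambda>y. \<Psi> (sin_map t y)) \<in> borel_measurable borel" by (rule borel_measurable_continuous_onI)
  obtain d where d: "\<And>y. \<bar>P (sin_map t y)\<bar> \<le> d" and mP: "(\<lambda>y. P (sin_map t y)) \<in> borel_measurable borel"
    using mult unfolding multiplier_def by metis
  have one: "L2 (\<lambda>_::'a. 1 :: real)" by (intro L2_poly poly_intros)
  have L1: "L2 (\<lambda>y. \<Psi> (sin_map t y) - P (sin_map t y))"
       "norm2 (\<lambda>y. \<Psi> (sin_map t y) - P (sin_map t y)) \<le> e' * c"
    using L2_bounded_mult[OF one, of "\<lambda>y. \<Psi> (sin_map t y) - P (sin_map t y)" e'] P(2)[OF K] m\<Psi> mP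
    by (auto simp: less_imp_le c_def)
  have L2P: "L2 (\<lambda>y. P (sin_map t y))" using L2_bounded_mult(1)[OF one mP d] by simp
  have L2: "L2 (\<lambda>y. P (sin_map t y) - p y)" by (intro L2_diff L2P L2_poly p)
  have "norm2 (\<lambda>y. \<Psi> (sin_map t y) - p y) < e"
    using norm2_add[OF L1(1) L2] L1(2) e'(2) p(2) by simp
  moreover have "L2 (\<lambda>y. \<Psi> (sin_map t y))" using L2_add[OF L1(1) L2P] by simp
  ultimately show ?thesis using that p(1) by blast
qed

end

section \<open>Localisation of positivity under the Carleman condition\<close>

context poly_measure
begin

lemma weighted_poly_measure:
  assumes h: "real_polynomial_function h"
  shows "poly_measure (density \<mu> (\<lambda>y. ennreal \<bar>h y\<bar>))"
proof
  show "sets (density \<mu> (\<lambda>y. ennreal \<bar>h y\<bar>)) = sets borel" by (simp add: sets_eq)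
  fix p :: "'a \<Rightarrow> real" assume p: "real_polynomial_function p"
  have "integrable \<mu> (\<lambda>y. h y * p y)" by (intro integrable_poly poly_intros h p)
  from integrable_abs[OF this] have "integrable \<mu> (\<lambda>y. \<bar>h y\<bar> * p y)"
    by (rule Bochner_Integration.integrable_bound)
       (use poly_measurable[OF h] poly_measurable[OF p] in \<open>auto simp: abs_mult\<close>)
  then show "integrable (density \<mu> (\<lambda>y. ennreal \<bar>h y\<bar>)) p"
    using poly_measurable[OF h] poly_measurable[OF p] by (subst integrable_density) auto
qed

text \<open>
  If \<open>h y0 < 0\<close>, let \<open>\<phi>\<close> be a bump supported in a ball around \<open>y0\<close> where \<open>h < 0\<close>. The integral of \<open>\<phi>\<^sup>2 h\<close> is
  negative because \<open>y0\<close> is in the support. It remains negative when \<open>\<phi> y\<close> is replaced by the value of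
  \<open>\<phi>\<close> at \<open>sin_map t y / t\<close> with \<open>t\<close> small, by dominated convergence, and then
  when that function is replaced by a polynomial close to it in quadratic mean with weight \<open>\<bar>h\<bar>\<close>.
\<close>

lemma nonneg_on_support:
  assumes h: "real_polynomial_function h"
    and sin: "\<And>b t. b \<in> Basis \<Longrightarrow> t \<ge> 0 \<Longrightarrow>
      poly_measure.multiplier (density \<mu> (\<lambda>y. ennreal \<bar>h y\<bar>)) (\<lambda>y. sin (t * (y \<bullet> b)))"
    and pos: "\<And>p. real_polynomial_function p \<Longrightarrow> 0 \<le> (\<integral>y. (p y)\<^sup>2 * h y \<partial>\<mu>)"
    and y0: "y0 \<in> measure_support \<mu>"
  shows "h y0 \<ge> 0"
proof (rule ccontr)
  assume "\<not> h y0 \<ge> 0"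
  interpret W: poly_measure "density \<mu> (\<lambda>y. ennreal \<bar>h y\<bar>)" by (rule weighted_poly_measure[OF h])
  have hm: "h \<in> borel_measurable borel" by (rule poly_measurable[OF h])
  have hi: "integrable \<mu> h" by (rule integrable_poly[OF h])
  have "continuous_on UNIV h" using h by (simp add: continuous_on_polymonial_function real_polynomial_function_eq)
  then have "open {y. h y < 0}" by (intro open_Collect_less continuous_on_const)
  then obtain \<delta> where \<delta>: "\<delta> > 0" "\<And>y. dist y y0 < \<delta> \<Longrightarrow> h y < 0"
    using \<open>\<not> h y0 \<ge> 0\<close> unfolding open_dist by (metis mem_Collect_eq not_le)
  \<comment> \<open>\<open>\<Psi> n\<close> is the bump after undoing the scaling by \<open>t = 1 / (n + 1)\<close>\<close>
  define \<Psi> where "\<Psi> n u = max 0 (\<delta> - dist (real (Suc n) *\<^sub>R u) y0)" for n and u :: 'a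
  define \<phi> where "\<phi> y = max 0 (\<delta> - dist y y0)" for y
  let ?s = "\<lambda>n y. sin_map (1 / real (Suc n)) y"
  have cont: "continuous_on UNIV (\<Psi> n)" for n unfolding \<Psi>_def by (intro continuous_intros)
  have cont\<phi>: "continuous_on UNIV \<phi>" unfolding \<phi>_def by (intro continuous_intros)
  have conts: "continuous_on UNIV (\<lambda>y. \<Psi> n (?s n y))" for n
    unfolding sin_map_def by (intro continuous_on_compose2[OF cont] continuous_intros) auto
  have m: "(\<lambda>y. \<Psi> n (?s n y)) \<in> borel_measurable borel" "\<phi> \<in> borel_measurable borel" for n
    by (intro borel_measurable_continuous_onI cont\<phi> conts)+
  have \<Psi>_bd: "0 \<le> \<Psi> n u" "\<Psi> n u \<le> \<delta>" for n u using \<delta>(1) by (auto simp: \<Psi>_def)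
  have \<phi>_bd: "0 \<le> \<phi> y" "\<phi> y \<le> \<delta>" for y using \<delta>(1) by (auto simp: \<phi>_def)
  have dom: "integrable \<mu> (\<lambda>y. \<delta>\<^sup>2 * \<bar>h y\<bar>)" using hi by auto
  have bd: "norm (c\<^sup>2 * h y) \<le> \<delta>\<^sup>2 * \<bar>h y\<bar>" if "0 \<le> c" "c \<le> \<delta>" for c y
    using that by (auto simp: abs_mult intro!: mult_right_mono power_mono)
  have lim: "(\<lambda>n. \<integral>y. (\<Psi> n (?s n y))\<^sup>2 * h y \<partial>\<mu>) \<longlonglongrightarrow> (\<integral>y. (\<phi> y)\<^sup>2 * h y \<partial>\<mu>)"
  proof (rule integral_dominated_convergence[OF _ _ dom])
    have "(\<lambda>n. \<Psi> n (?s n y)) \<longlonglongrightarrow> \<phi> y" for y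
      unfolding \<Psi>_def \<phi>_def
      by (intro tendsto_max tendsto_const tendsto_diff tendsto_dist sin_map_scaled_limit)
    then show "AE y in \<mu>. (\<lambda>n. (\<Psi> n (?s n y))\<^sup>2 * h y) \<longlonglongrightarrow> (\<phi> y)\<^sup>2 * h y"
      by (intro AE_I2 tendsto_mult tendsto_power tendsto_const)
    show "AE y in \<mu>. norm ((\<Psi> n (?s n y))\<^sup>2 * h y) \<le> \<delta>\<^sup>2 * \<bar>h y\<bar>" for n
      by (intro AE_I2 bd \<Psi>_bd)
  qed (use m hm in auto)
  have int\<phi>: "integrable \<mu> (\<lambda>y. (\<phi> y)\<^sup>2 * h y)"
    by (rule Bochner_Integration.integrable_bound[OF dom]) (use m hm bd[OF \<phi>_bd] in auto)
  have nonpos: "(\<phi> y)\<^sup>2 * h y \<le> 0" for y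
  proof (cases "dist y y0 < \<delta>")
    case True
    then show ?thesis using \<delta>(2)[of y] by (simp add: mult_nonneg_nonpos)
  qed (simp add: \<phi>_def)
  have "(\<integral>y. (\<phi> y)\<^sup>2 * h y \<partial>\<mu>) \<noteq> 0"
  proof
    assume "(\<integral>y. (\<phi> y)\<^sup>2 * h y \<partial>\<mu>) = 0"
    then have "(\<integral>y. - ((\<phi> y)\<^sup>2 * h y) \<partial>\<mu>) = 0" by simp
    then have "AE y in \<mu>. - ((\<phi> y)\<^sup>2 * h y) = 0"
      using int\<phi> nonpos by (subst (asm) integral_nonneg_eq_0_iff_AE) auto
    then have "AE y in \<mu>. \<not> dist y y0 < \<delta>"
    proof eventually_elim
      case (elim y)
      then show ?case using \<delta>(2)[of y] by (auto simp: \<phi>_def)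
    qed
    then have "AE y in \<mu>. y \<notin> ball y0 \<delta>" by (simp add: dist_commute)
    then have "emeasure \<mu> (ball y0 \<delta>) = 0"
      by (subst (asm) AE_iff_measurable[OF _ refl]) (auto simp: sets_eq sets_eq_imp_space_eq[OF sets_eq] ball_def)
    moreover have "emeasure \<mu> (ball y0 \<delta>) > 0" using y0 \<delta>(1) by (auto simp: measure_support_def)
    ultimately show False by simp
  qed
  moreover have "(\<integral>y. (\<phi> y)\<^sup>2 * h y \<partial>\<mu>) \<le> 0"
    using Bochner_Integration.integral_nonneg[of \<mu> "\<lambda>y. - ((\<phi> y)\<^sup>2 * h y)"] nonpos by simp
  ultimately have "(\<integral>y. (\<phi> y)\<^sup>2 * h y \<partial>\<mu>) < 0" by linarith
  from order_tendstoD(2)[OF lim this] obtain n where n: "(\<integral>y. (\<Psi> n (?s n y))\<^sup>2 * h y \<partial>\<mu>) < 0"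
    by (auto simp: eventually_sequentially)
  define \<eta> where "\<eta> = - (\<integral>y. (\<Psi> n (?s n y))\<^sup>2 * h y \<partial>\<mu>)"
  define F where "F y = \<Psi> n (?s n y)" for y
  have F_eq: "F = (\<lambda>y. \<Psi> n (?s n y))" by (simp add: F_def fun_eq_iff)
  have mult: "W.multiplier (\<lambda>y. sin (1 / real (Suc n) * (y \<bullet> b)))" if "b \<in> Basis" for b
    by (rule sin[OF that]) simp
  \<comment> \<open>the integrals of \<open>F\<^sup>2 h\<close> and \<open>p\<^sup>2 h\<close> differ by at most \<open>a (2 \<parallel>F\<parallel> + a)\<close> with \<open>a = \<parallel>F - p\<parallel>\<close>;
    this choice keeps it below \<open>\<eta>\<close>\<close>
  define e where "e = min 1 (\<eta> / (2 * W.norm2 F + 2))"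
  have "\<eta> > 0" "2 * W.norm2 F + 2 > 0" using n W.norm2_nonneg[of F] by (auto simp: \<eta>_def)
  then have "e > 0" unfolding e_def by (intro min_less_iff_conj[THEN iffD2] conjI divide_pos_pos) auto
  obtain p where p: "real_polynomial_function p" "W.norm2 (\<lambda>y. F y - p y) < e" and F: "W.L2 F"
    using W.approx_continuous_sin_map[OF mult cont[of n] \<open>e > 0\<close>] unfolding F_eq by blast
  have pL: "W.L2 p" by (rule W.L2_poly[OF p(1)])
  define a where "a = W.norm2 (\<lambda>y. F y - p y)"
  have a: "0 \<le> a" "a < e" using p(2) W.norm2_nonneg by (auto simp: a_def)
  have D: "W.L2 (\<lambda>y. F y - p y)" by (rule W.L2_diff[OF F pL])
  have S: "W.L2 (\<lambda>y. F y + p y)" by (rule W.L2_add[OF F pL])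
  have "W.norm2 (\<lambda>y. F y + p y) = W.norm2 (\<lambda>y. 2 * F y + (- 1) * (F y - p y))"
    by (simp add: algebra_simps)
  also have "\<dots> \<le> 2 * W.norm2 F + a"
    using W.norm2_add[OF W.L2_cmult[OF F, of 2] W.L2_cmult[OF D, of "-1"]]
      W.norm2_cmult[OF F, of 2] W.norm2_cmult[OF D, of "-1"] by (simp add: a_def)
  finally have Sb: "W.norm2 (\<lambda>y. F y + p y) \<le> 2 * W.norm2 F + a" .
  have FpI: "integrable \<mu> (\<lambda>y. (F y - p y) * (F y + p y) * h y)" (is "integrable _ ?g")
    and Fpb: "(\<integral>y. \<bar>(F y - p y) * (F y + p y) * h y\<bar> \<partial>\<mu>) \<le> a * (2 * W.norm2 F + a)"
  proof -
    note cs = W.cauchy_schwarz[OF D S]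
    have gm: "(\<lambda>y. (F y - p y) * (F y + p y)) \<in> borel_measurable borel"
      using D S by (auto simp: W.L2_def)
    have "integrable \<mu> (\<lambda>y. \<bar>h y\<bar> * ((F y - p y) * (F y + p y)))"
      using cs(1) gm hm by (subst (asm) integrable_density) auto
    then show *: "integrable \<mu> ?g"
      by (rule Bochner_Integration.integrable_bound) (use gm hm in \<open>auto simp: abs_mult\<close>)
    have "(\<integral>y. \<bar>?g y\<bar> \<partial>\<mu>) = (\<integral>y. \<bar>(F y - p y) * (F y + p y)\<bar> \<partial>(density \<mu> (\<lambda>y. ennreal \<bar>h y\<bar>)))"
    proof (subst integral_density)
      show "(\<lambda>y. \<bar>(F y - p y) * (F y + p y)\<bar>) \<in> borel_measurable \<mu>" using gm by simp
    qed (use hm in \<open>auto simp: abs_mult mult_ac\<close>)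
    also have "\<dots> \<le> a * W.norm2 (\<lambda>y. F y + p y)" using cs(2) by (simp add: a_def)
    also have "\<dots> \<le> a * (2 * W.norm2 F + a)" using Sb a by (intro mult_left_mono) auto
    finally show "(\<integral>y. \<bar>?g y\<bar> \<partial>\<mu>) \<le> a * (2 * W.norm2 F + a)" .
  qed
  have "integrable \<mu> (\<lambda>y. (F y)\<^sup>2 * h y)"
    by (rule Bochner_Integration.integrable_bound[OF dom]) (use m hm bd[OF \<Psi>_bd] in \<open>auto simp: F_def\<close>)
  moreover have "(p y)\<^sup>2 * h y = (F y)\<^sup>2 * h y - ?g y" for y
    by (simp add: algebra_simps power2_eq_square)
  ultimately have "(\<integral>y. (p y)\<^sup>2 * h y \<partial>\<mu>) = - \<eta> - (\<integral>y. ?g y \<partial>\<mu>)"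
    using FpI by (simp add: \<eta>_def F_def)
  moreover have "- (\<integral>y. ?g y \<partial>\<mu>) \<le> a * (2 * W.norm2 F + a)"
    using integral_abs_bound[of \<mu> ?g] Fpb by linarith
  moreover have "a * (2 * W.norm2 F + a) < \<eta>"
  proof -
    have "a * (2 * W.norm2 F + a) \<le> a * (2 * W.norm2 F + 2)"
      using a by (intro mult_left_mono) (auto simp: e_def)
    also have "\<dots> < e * (2 * W.norm2 F + 2)"
      using a W.norm2_nonneg[of F] by (intro mult_strict_right_mono) auto
    also have "\<dots> \<le> \<eta> / (2 * W.norm2 F + 2) * (2 * W.norm2 F + 2)"
      using W.norm2_nonneg[of F] by (intro mult_right_mono) (auto simp: e_def)
    also have "\<dots> = \<eta>" using W.norm2_nonneg[of F] by simp
    finally show ?thesis .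
  qed
  ultimately show False using pos[OF p(1)] by linarith
qed

end

section \<open>Moments under the Carleman condition\<close>

text \<open>
  For a log-convex sequence the ratios \<open>m d / m (d + 1)\<close> decrease, and the terms of Carleman's series are,
  up to a bounded factor, geometric means of their square roots. So Carleman's inequality transfers the
  divergence to the ratios. Monotonicity allows passing to every other ratio: the weight \<open>\<bar>h\<bar>\<close> is
  split off by the Cauchy-Schwarz inequality, which leaves only the moments of order divisible by four.
\<close>

lemma log_convex_ratios:
  fixes m :: "nat \<Rightarrow> real"
  assumes m: "\<And>d. m d > 0" and lc: "\<And>d. (m (Suc d))\<^sup>2 \<le> m d * m (Suc (Suc d))"
    and div: "\<not> summable (\<lambda>d. m (Suc d) powr (- 1 / (2 * real (Suc d))))"
  defines "r \<equiv> \<lambda>d. sqrt (m d / m (Suc d))"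
  shows "\<And>d. r d > 0" "decseq r" "\<not> summable (\<lambda>n. r (2 * n + 1))"
proof -
  show r: "r d > 0" for d using m by (simp add: r_def)
  show dec: "decseq r"
    unfolding r_def decseq_Suc_iff using m lc
    by (auto simp: field_simps power2_eq_square)
  have prod: "(\<Prod>k\<le>n. r k) = sqrt (m 0 / m (Suc n))" for n
  proof (induction n)
    case (Suc n)
    have "m (Suc n) \<noteq> 0" using m[of "Suc n"] by simp
    then show ?case using Suc by (simp add: r_def real_sqrt_divide)
  qed (simp add: r_def)
  have nr: "\<not> summable r"
  proof
    assume "summable r"
    then have s: "summable (\<lambda>n. root (Suc n) (\<Prod>k\<le>n. r k))"
      using r by (intro carleman_inequality) (auto simp: less_imp_le)
    have "summable (\<lambda>d. m (Suc d) powr (- 1 / (2 * real (Suc d))))"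
    proof (rule summable_comparison_test'[OF summable_mult[OF s]])
      fix n :: nat
      let ?e = "1 / (2 * real (Suc n))"
      have e: "0 < ?e" "?e \<le> 1" by auto
      have "root (Suc n) (\<Prod>k\<le>n. r k) = (m 0 / m (Suc n)) powr ?e"
        unfolding prod using m by (simp add: root_powr_inverse powr_half_sqrt[symmetric] powr_powr less_imp_le del: of_nat_Suc)
      also have "\<dots> = m 0 powr ?e * m (Suc n) powr (- ?e)"
        using m by (simp add: powr_divide powr_minus_divide less_imp_le)
      finally have eq: "m (Suc n) powr (- ?e) = m 0 powr (- ?e) * root (Suc n) (\<Prod>k\<le>n. r k)"
        using m[of 0] by (simp add: powr_minus field_simps)
      have "m 0 powr (- ?e) \<le> max 1 (1 / m 0)"
      proof (cases "m 0 \<ge> 1")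
        case True
        have "m 0 powr (- ?e) \<le> m 0 powr 0" using True e by (intro powr_mono) auto
        then show ?thesis using m[of 0] by simp
      next
        case False
        have "m 0 powr (- ?e) \<le> m 0 powr (- 1)" using False e m[of 0] by (intro powr_mono') auto
        then show ?thesis using m[of 0] by (simp add: powr_minus_divide)
      qed
      then have "m (Suc n) powr (- ?e) \<le> max 1 (1 / m 0) * root (Suc n) (\<Prod>k\<le>n. r k)"
        unfolding eq using r by (intro mult_right_mono real_root_ge_zero prod_nonneg) (auto simp: less_imp_le)
      then show "norm (m (Suc n) powr (- 1 / (2 * real (Suc n)))) \<le> max 1 (1 / m 0) * root (Suc n) (\<Prod>k\<le>n. r k)"
        by simp
    qed
    then show False using div by simp
  qed
  show "\<not> summable (\<lambda>n. r (2 * n + 1))"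
  proof
    assume s: "summable (\<lambda>n. r (2 * n + 1))"
    have 1: "(\<Sum>k<2 * n + 1. r k) \<le> r 0 + 2 * (\<Sum>i<n. r (2 * i + 1))" for n
    proof (induction n)
      case (Suc n)
      have "r (2 * n + 2) \<le> r (2 * n + 1)" using decseqD[OF dec] by simp
      then show ?case using Suc by (simp add: algebra_simps)
    qed simp
    have 2: "(\<Sum>i<n. r (2 * i + 1)) \<le> (\<Sum>n. r (2 * n + 1))" for n
      using r by (intro sum_le_suminf s) (auto simp: less_imp_le)
    have 3: "(\<Sum>k<n. r k) \<le> (\<Sum>k<2 * n + 1. r k)" for n
      using r by (intro sum_mono2) (auto simp: less_imp_le)
    have "(\<Sum>k<n. r k) \<le> r 0 + 2 * (\<Sum>n. r (2 * n + 1))" for n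
      using 1[of n] 2[of n] 3[of n] by linarith
    then have "summable r" using r by (intro summableI_nonneg_bounded) (auto simp: less_imp_le)
    then show False using nr by simp
  qed
qed

context poly_measure
begin

text \<open>
  With weight \<open>\<bar>h\<bar>\<close>, the Cauchy-Schwarz inequality bounds the squared norm of \<open>y\<^sub>b\<^sup>n q\<close> by a constant times
  the square root of the moment of order \<open>4 n\<close>; hence \<open>M n\<close> below involves a fourth root. If some even
  moment vanishes, then so does \<open>sin (t y\<^sub>b)\<close> almost everywhere; the divergence is only assumed otherwise.
\<close>

lemma carleman_multiplier:
  assumes h: "real_polynomial_function h"
    and carleman: "(\<And>d. (\<integral>y. (y \<bullet> b) ^ (2 * d) \<partial>\<mu>) > 0) \<Longrightarrow>
      \<not> summable (\<lambda>d. (\<integral>y. (y \<bullet> b) ^ (2 * Suc d) \<partial>\<mu>) powr (- 1 / (2 * real (Suc d))))"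
    and t: "t \<ge> 0"
  shows "poly_measure.multiplier (density \<mu> (\<lambda>y. ennreal \<bar>h y\<bar>)) (\<lambda>y. sin (t * (y \<bullet> b)))"
proof -
  interpret W: poly_measure "density \<mu> (\<lambda>y. ennreal \<bar>h y\<bar>)" by (rule weighted_poly_measure[OF h])
  have hm: "h \<in> borel_measurable borel" by (rule poly_measurable[OF h])
  define m where "m d = (\<integral>y. (y \<bullet> b) ^ (2 * d) \<partial>\<mu>)" for d
  have power_poly: "real_polynomial_function (\<lambda>y. (y \<bullet> b) ^ k)" for k
    by (intro poly_intros poly_inner)
  have sin_m: "(\<lambda>y. sin (t * (y \<bullet> b))) \<in> borel_measurable borel"
    by (intro borel_measurable_continuous_onI continuous_intros)
  have "\<exists>p. real_polynomial_function p \<and> W.norm2 (\<lambda>y. sin (t * (y \<bullet> b)) * q y - p y) < e"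
    if q: "real_polynomial_function q" and e: "e > 0" for q e
  proof (cases "\<exists>d. m d \<le> 0")
    case True
    then obtain d where "m d \<le> 0" by blast
    moreover have "m d \<ge> 0" unfolding m_def by (intro Bochner_Integration.integral_nonneg) (simp add: power_mult)
    ultimately have "(\<integral>y. (y \<bullet> b) ^ (2 * d) \<partial>\<mu>) = 0" unfolding m_def by (rule antisym)
    then have "AE y in \<mu>. (y \<bullet> b) ^ (2 * d) = 0"
    proof (subst (asm) integral_nonneg_eq_0_iff_AE)
      show "AE y in \<mu>. 0 \<le> (y \<bullet> b) ^ (2 * d)" by (simp add: power_mult)
    qed (intro integrable_poly power_poly)
    then have "AE y in \<mu>. (norm (sin (t * (y \<bullet> b)) * q y - 0))\<^sup>2 = 0"
      by eventually_elim (auto simp: power_0_left split: if_splits)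
    then have "AE y in density \<mu> (\<lambda>y. ennreal \<bar>h y\<bar>). (norm (sin (t * (y \<bullet> b)) * q y - 0))\<^sup>2 = 0"
      using hm by (subst AE_density) auto
    then have "W.norm2 (\<lambda>y. sin (t * (y \<bullet> b)) * q y - 0) = 0"
      unfolding W.norm2_def by (subst integral_eq_zero_AE) auto
    then show ?thesis using e real_polynomial_function.intros(2)[of 0] by (intro exI[of _ "\<lambda>_. 0"]) auto
  next
    case False
    then have m: "m d > 0" for d by (simp add: not_le)
    have lc: "(m (Suc d))\<^sup>2 \<le> m d * m (Suc (Suc d))" for d
    proof -
      have sq: "(norm2 (\<lambda>y. (y \<bullet> b) ^ k))\<^sup>2 = m k" for k
        by (simp add: norm2_square m_def power_mult[symmetric] mult.commute)
      have "m (Suc d) = (\<integral>y. \<bar>(y \<bullet> b) ^ d * (y \<bullet> b) ^ Suc (Suc d)\<bar> \<partial>\<mu>)"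
      proof -
        have "(u::real) ^ d * u ^ Suc (Suc d) = (u ^ Suc d)\<^sup>2" for u
          by (simp add: power2_eq_square algebra_simps)
        then show ?thesis by (simp only: m_def abs_power2 power_even_eq)
      qed
      also have "\<dots> \<le> norm2 (\<lambda>y. (y \<bullet> b) ^ d) * norm2 (\<lambda>y. (y \<bullet> b) ^ Suc (Suc d))"
        by (rule cauchy_schwarz(2)[OF L2_poly[OF power_poly] L2_poly[OF power_poly]])
      finally have "(m (Suc d))\<^sup>2 \<le> (norm2 (\<lambda>y. (y \<bullet> b) ^ d) * norm2 (\<lambda>y. (y \<bullet> b) ^ Suc (Suc d)))\<^sup>2"
        using m[of "Suc d"] by (intro power_mono) auto
      then show ?thesis by (simp only: power_mult_distrib sq)
    qed
    have div: "\<not> summable (\<lambda>d. m (Suc d) powr (- 1 / (2 * real (Suc d))))"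
      unfolding m_def by (rule carleman) (rule m[unfolded m_def])
    note ratio = log_convex_ratios[OF m lc div]
    have q2h: "real_polynomial_function (\<lambda>y. (q y)\<^sup>2 * h y)" by (intro poly_intros q h)
    define C where "C = sqrt (norm2 (\<lambda>y. (q y)\<^sup>2 * h y)) + 1"
    have C: "C > 0" unfolding C_def using norm2_nonneg by (intro add_nonneg_pos) auto
    \<comment> \<open>the increment \<open>1\<close> in \<open>C\<close> keeps \<open>M\<close> positive; \<open>m (2 n)\<close> is the moment of order \<open>4 n\<close>, and \<open>\<rho> n\<close>
      uses the later, hence smaller, of the two ratios between \<open>m (2 n)\<close> and \<open>m (2 n + 2)\<close>\<close>
    define M where "M n = C * sqrt (sqrt (m (2 * n)))" for n
    define \<rho> where "\<rho> n = sqrt (m (2 * n + 1) / m (Suc (2 * n + 1)))" for n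
    obtain p where "real_polynomial_function p" "W.norm2 (\<lambda>y. sin (t * (y \<bullet> b)) * q y - p y) < e"
    proof (rule W.sin_approx[OF q _ _ _ _ _ _ t e, of M b \<rho>])
      show "M n > 0" for n using C m by (simp add: M_def)
      show "\<rho> n > 0" for n using ratio(1) by (simp add: \<rho>_def)
      show "decseq \<rho>" using ratio(2) unfolding decseq_def \<rho>_def by simp
      show "\<not> summable \<rho>" using ratio(3) by (simp add: \<rho>_def[abs_def])
      show "M (Suc n) * \<rho> n \<le> M n" for n
      proof -
        let ?a = "m (2 * n)" and ?b = "m (Suc (2 * n))" and ?c = "m (Suc (Suc (2 * n)))"
        have "?c * (?b / ?c)\<^sup>2 \<le> ?a"
          using lc[of "2 * n"] m[of "Suc (Suc (2 * n))"] by (simp add: field_simps power2_eq_square)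
        then have "sqrt (sqrt (?c * (?b / ?c)\<^sup>2)) \<le> sqrt (sqrt ?a)" by (intro real_sqrt_le_mono)
        moreover have "sqrt (sqrt (?c * (?b / ?c)\<^sup>2)) = sqrt (sqrt ?c) * sqrt (?b / ?c)"
          using m by (simp only: real_sqrt_mult real_sqrt_abs abs_of_pos divide_pos_pos)
        ultimately have "sqrt (sqrt ?c) * sqrt (?b / ?c) \<le> sqrt (sqrt ?a)" by simp
        then show ?thesis using C by (simp add: M_def \<rho>_def mult.assoc)
      qed
      show "W.norm2 (\<lambda>y. (y \<bullet> b) ^ n * q y) \<le> M n" for n
      proof -
        have "(W.norm2 (\<lambda>y. (y \<bullet> b) ^ n * q y))\<^sup>2 = (\<integral>y. \<bar>h y\<bar> * ((y \<bullet> b) ^ n * q y)\<^sup>2 \<partial>\<mu>)"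
          unfolding W.norm2_square using hm poly_measurable[OF power_poly] poly_measurable[OF q]
          by (subst integral_density) auto
        also have "\<dots> = (\<integral>y. \<bar>(y \<bullet> b) ^ (2 * n) * ((q y)\<^sup>2 * h y)\<bar> \<partial>\<mu>)"
          by (intro Bochner_Integration.integral_cong refl) (subst power_even_eq, simp only: abs_mult power_mult_distrib abs_power2 mult_ac)
        also have "\<dots> \<le> norm2 (\<lambda>y. (y \<bullet> b) ^ (2 * n)) * norm2 (\<lambda>y. (q y)\<^sup>2 * h y)"
          by (rule cauchy_schwarz(2)[OF L2_poly[OF power_poly] L2_poly[OF q2h]])
        also have "norm2 (\<lambda>y. (y \<bullet> b) ^ (2 * n)) = sqrt (m (2 * n))"
          by (simp add: norm2_def m_def power_mult[symmetric] mult_ac)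
        finally have "W.norm2 (\<lambda>y. (y \<bullet> b) ^ n * q y) \<le> sqrt (sqrt (m (2 * n)) * norm2 (\<lambda>y. (q y)\<^sup>2 * h y))"
          by (rule real_le_rsqrt)
        also have "\<dots> = (C - 1) * sqrt (sqrt (m (2 * n)))" by (simp add: C_def real_sqrt_mult)
        also have "\<dots> \<le> M n" unfolding M_def using m by (intro mult_right_mono) (auto simp: less_imp_le)
        finally show ?thesis .
      qed
    qed
    then show ?thesis by blast
  qed
  then show ?thesis unfolding W.multiplier_def using sin_m by (auto intro!: exI[of _ 1])
qed

end

section \<open>The quadratic module of a family of constraints\<close>

lemma Basis_vec_axis: "b \<in> Basis \<Longrightarrow> \<exists>j. b = axis j (1::real)"
  by (auto simp: Basis_vec_def)

text \<open>
  Integrability of \<open>p\<close> alone does not pass to products of polynomials. The induction therefore proves that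
  multiplication by \<open>p\<close> preserves the class of functions that are integrable against all monomials.
\<close>

lemma poly_measure_of_moments:
  fixes \<nu> :: "(real ^ 'm) measure"
  assumes sets: "sets \<nu> = sets borel" and mom: "finite_moments \<nu>"
  shows "poly_measure \<nu>"
proof
  let ?mono = "\<lambda>\<alpha> (y :: real ^ 'm). \<Prod>j\<in>UNIV. (y $ j) ^ \<alpha> j"
  have upd: "?mono (\<alpha>(j := Suc (\<alpha> j))) y = (y $ j) * ?mono \<alpha> y" for \<alpha> j y
    by (simp add: prod.remove[of UNIV j] mult.assoc)
  have "\<forall>\<alpha>. integrable \<nu> (\<lambda>y. ?mono \<alpha> y * (g y * p y))"
    if "real_polynomial_function p" "\<forall>\<alpha>. integrable \<nu> (\<lambda>y. ?mono \<alpha> y * g y)" for p g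
    using that
  proof (induction arbitrary: g)
    case (linear l)
    show ?case
    proof
      fix \<alpha>
      have "integrable \<nu> (\<lambda>y. \<Sum>b\<in>Basis. l b * ((y \<bullet> b) * ?mono \<alpha> y * g y))"
      proof (intro Bochner_Integration.integrable_sum integrable_mult_right)
        fix b :: "real ^ 'm" assume "b \<in> Basis"
        then obtain j where b: "b = axis j 1" using Basis_vec_axis by blast
        show "integrable \<nu> (\<lambda>y. (y \<bullet> b) * ?mono \<alpha> y * g y)"
          using linear(2)[rule_format, of "\<alpha>(j := Suc (\<alpha> j))"] unfolding upd by (simp add: b inner_axis)
      qed
      moreover have "(\<Sum>b\<in>Basis. l b * ((y \<bullet> b) * ?mono \<alpha> y * g y)) = ?mono \<alpha> y * (g y * l y)" for y
        unfolding linear_as_coordinates[OF linear(1), of y] by (simp add: sum_distrib_left mult_ac)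
      ultimately show "integrable \<nu> (\<lambda>y. ?mono \<alpha> y * (g y * l y))" by simp
    qed
  next
    case (const c)
    then show ?case by (simp add: mult.assoc[symmetric])
  next
    case (add p q)
    have "integrable \<nu> (\<lambda>y. ?mono \<alpha> y * (g y * p y) + ?mono \<alpha> y * (g y * q y))" for \<alpha>
      using add by (intro Bochner_Integration.integrable_add) auto
    then show ?case by (simp add: distrib_left)
  next
    case (mult p q)
    from mult.IH(2)[OF mult.IH(1)[OF mult.prems]] show ?case by (simp add: mult.assoc)
  qed
  note step = this
  fix p :: "real ^ 'm \<Rightarrow> real" assume "real_polynomial_function p"
  from step[OF this, of "\<lambda>_. 1"] have "\<forall>\<alpha>. integrable \<nu> (\<lambda>y. ?mono \<alpha> y * p y)"
    using mom by (simp add: finite_moments_def)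
  from this[rule_format, of "\<lambda>_. 0"] show "integrable \<nu> p" by simp
qed (rule sets)

context poly_measure
begin

text \<open>
  As for moments, the claim is strengthened to make products tractable: multiplication by \<open>q\<close> preserves
  the class of functions whose integrals against all polynomials in \<open>y\<close> exist and are polynomial in \<open>x\<close>.
\<close>

lemma partial_integral:
  fixes q :: "'b::real_normed_vector \<times> 'a \<Rightarrow> real"
  assumes "real_polynomial_function q"
  shows integrable_section: "integrable \<mu> (\<lambda>y. q (x, y))"
    and partial_integral_poly: "real_polynomial_function (\<lambda>x. \<integral>y. q (x, y) \<partial>\<mu>)"
proof -
  define fam where "fam g \<longleftrightarrow> (\<forall>b. real_polynomial_function b \<longrightarrow>
      real_polynomial_function (\<lambda>x. \<integral>y. g (x, y) * b y \<partial>\<mu>) \<and> (\<forall>x. integrable \<mu> (\<lambda>y. g (x, y) * b y)))"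
    for g :: "'b \<times> 'a \<Rightarrow> real"
  have step: "fam (\<lambda>z. g z * q z)" if "real_polynomial_function q" "fam g" for q g
    using that
  proof (induction arbitrary: g)
    case (linear l)
    note lin = linear
    interpret bounded_linear l by fact
    have l: "l (x, y) = l (x, 0) + l (0, y)" for x y using add[of "(x, 0)" "(0, y)"] by simp
    have l1: "real_polynomial_function (\<lambda>x. l (x, 0))" and l2: "real_polynomial_function (\<lambda>y. l (0, y))"
      by (intro real_polynomial_function.intros(1) bounded_linear_compose[OF lin(1)]
          bounded_linear_Pair bounded_linear_ident bounded_linear_zero)+
    show ?case unfolding fam_def
    proof (intro allI impI)
      fix b :: "'a \<Rightarrow> real" assume b: "real_polynomial_function b"
      then have b': "real_polynomial_function (\<lambda>y. l (0, y) * b y)" using l2 by (intro poly_intros)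
      have eq: "g (x, y) * l (x, y) * b y = l (x, 0) * (g (x, y) * b y) + g (x, y) * (l (0, y) * b y)" for x y
        unfolding l[of x y] by (simp add: algebra_simps)
      have i: "integrable \<mu> (\<lambda>y. g (x, y) * b y)" "integrable \<mu> (\<lambda>y. g (x, y) * (l (0, y) * b y))" for x
        using lin(2) b b' unfolding fam_def by blast+
      have p: "real_polynomial_function (\<lambda>x. \<integral>y. g (x, y) * b y \<partial>\<mu>)"
          "real_polynomial_function (\<lambda>x. \<integral>y. g (x, y) * (l (0, y) * b y) \<partial>\<mu>)"
        using lin(2) b b' unfolding fam_def by blast+
      have "real_polynomial_function (\<lambda>x. l (x, 0) * (\<integral>y. g (x, y) * b y \<partial>\<mu>) + (\<integral>y. g (x, y) * (l (0, y) * b y) \<partial>\<mu>))"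
        by (intro poly_intros l1 p)
      then show "real_polynomial_function (\<lambda>x. \<integral>y. g (x, y) * l (x, y) * b y \<partial>\<mu>) \<and>
          (\<forall>x. integrable \<mu> (\<lambda>y. g (x, y) * l (x, y) * b y))"
        unfolding eq using i by simp
    qed
  next
    case (const c)
    show ?case unfolding fam_def
    proof (intro allI impI)
      fix b :: "'a \<Rightarrow> real" assume "real_polynomial_function b"
      then have "real_polynomial_function (\<lambda>y. c * b y)" by (intro poly_intros)
      then show "real_polynomial_function (\<lambda>x. \<integral>y. g (x, y) * c * b y \<partial>\<mu>) \<and>
          (\<forall>x. integrable \<mu> (\<lambda>y. g (x, y) * c * b y))"
        using const unfolding fam_def by (simp add: mult.assoc)
    qed
  next
    case (add p q)
    note fp = add.IH(1)[OF add.prems] and fq = add.IH(2)[OF add.prems]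
    show ?case unfolding fam_def
    proof (intro allI impI)
      fix b :: "'a \<Rightarrow> real" assume b: "real_polynomial_function b"
      have eq: "g z * (p z + q z) * b y = g z * p z * b y + g z * q z * b y" for z y
        by (simp add: algebra_simps)
      show "real_polynomial_function (\<lambda>x. \<integral>y. g (x, y) * (p (x, y) + q (x, y)) * b y \<partial>\<mu>) \<and>
          (\<forall>x. integrable \<mu> (\<lambda>y. g (x, y) * (p (x, y) + q (x, y)) * b y))"
        unfolding eq using fp fq b unfolding fam_def by (simp add: real_polynomial_function.intros(3))
    qed
  next
    case (mult p q)
    from mult.IH(2)[OF mult.IH(1)[OF mult.prems]] show ?case by (simp add: mult.assoc)
  qed
  have "fam (\<lambda>_. 1)"
    unfolding fam_def by (simp add: integrable_poly real_polynomial_function.intros(2))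
  from step[OF assms this] have "fam q" by simp
  from this[unfolded fam_def, rule_format, OF real_polynomial_function.intros(2)[of 1]]
  show "integrable \<mu> (\<lambda>y. q (x, y))" "real_polynomial_function (\<lambda>x. \<integral>y. q (x, y) \<partial>\<mu>)"
    by simp_all
qed

end

lemma section_polynomial:
  assumes "real_polynomial_function (q :: 'b::real_normed_vector \<times> 'a::real_normed_vector \<Rightarrow> real)"
  shows "real_polynomial_function (\<lambda>y. q (x, y))"
proof -
  have "polynomial_function (\<lambda>y :: 'a. (x, 0) + (0 :: 'b, y))"
    by (intro polynomial_function_add polynomial_function_const polynomial_function_bounded_linear
        bounded_linear_Pair bounded_linear_zero bounded_linear_ident)
  from real_polynomial_function_compose[OF this assms] show ?thesis by (simp add: o_def)
qed

lemma polynomial_of_fst: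
  assumes "real_polynomial_function (p :: 'b::real_normed_vector \<Rightarrow> real)"
  shows "real_polynomial_function (\<lambda>z :: 'b \<times> 'a::real_normed_vector. p (fst z))"
  using real_polynomial_function_compose[OF polynomial_function_bounded_linear[OF bounded_linear_fst] assms]
  by (simp add: o_def)

lemma polynomial_of_snd:
  assumes "real_polynomial_function (p :: 'a::real_normed_vector \<Rightarrow> real)"
  shows "real_polynomial_function (\<lambda>z :: 'b::real_normed_vector \<times> 'a. p (snd z))"
  using real_polynomial_function_compose[OF polynomial_function_bounded_linear[OF bounded_linear_snd] assms]
  by (simp add: o_def)

lemma quadratic_moduleI:
  assumes "\<And>j. j \<le> s \<Longrightarrow> \<tau> j \<in> sum_of_squares" "\<And>x. p x = (\<Sum>j\<le>s. \<integral>y. \<tau> j (x, y) * g j (x, y) \<partial>\<nu>)"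
  shows "p \<in> quadratic_module s g \<nu>"
  using assms unfolding quadratic_module_def by (auto simp: fun_eq_iff)

lemma quadratic_module_single:
  assumes "\<tau> \<in> sum_of_squares" "k \<le> s"
  shows "(\<lambda>x. \<integral>y. \<tau> (x, y) * g k (x, y) \<partial>\<nu>) \<in> quadratic_module s g \<nu>"
proof (rule quadratic_moduleI)
  let ?\<tau> = "\<lambda>j. if j = k then \<tau> else (\<lambda>_. 0)"
  show "?\<tau> j \<in> sum_of_squares" for j using assms sos_zero by auto
  have "(\<Sum>j\<le>s. \<integral>y. ?\<tau> j (x, y) * g j (x, y) \<partial>\<nu>) = (\<Sum>j\<le>s. if j = k then \<integral>y. \<tau> (x, y) * g k (x, y) \<partial>\<nu> else 0)" for x
    by (intro sum.cong) auto
  then show "(\<integral>y. \<tau> (x, y) * g k (x, y) \<partial>\<nu>) = (\<Sum>j\<le>s. \<integral>y. ?\<tau> j (x, y) * g j (x, y) \<partial>\<nu>)" for x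
    using assms(2) by simp
qed

text \<open>
  The constant \<open>1\<close> is the integral of \<open>1 / \<nu>(\<real>\<^sup>m)\<close>, provided \<open>\<nu>\<close> is not zero. For the zero measure the
  quadratic module contains only the zero function, which contradicts the archimedean property
  at \<open>x = 0\<close>.
\<close>

lemma quadratic_module_archimedean:
  fixes g :: "nat \<Rightarrow> (real ^ 'n) \<times> (real ^ 'm) \<Rightarrow> real" and \<nu> :: "(real ^ 'm) measure"
  assumes "poly_measure \<nu>"
    and g: "\<And>j. j \<le> s \<Longrightarrow> real_polynomial_function (g j)"
    and g0: "g 0 = (\<lambda>_. 1)"
    and arch: "archimedean (quadratic_module s g \<nu>)"
  obtains N where "archimedean_quadratic_module (quadratic_module s g \<nu>) N"
proof -
  interpret poly_measure \<nu> by fact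
  let ?M = "quadratic_module s g \<nu>"
  obtain N :: int where N: "N > 0" "(\<lambda>x. of_int N - (\<Sum>i\<in>UNIV. (x $ i)\<^sup>2)) \<in> ?M"
    using arch unfolding archimedean_def by auto
  have int: "integrable \<nu> (\<lambda>y. \<tau> (x, y) * g j (x, y))" "real_polynomial_function (\<lambda>x. \<integral>y. \<tau> (x, y) * g j (x, y) \<partial>\<nu>)"
    if "j \<le> s" "\<tau> \<in> sum_of_squares" for \<tau> j x
    using partial_integral[OF real_polynomial_function.intros(4)[OF sos_polynomial[OF that(2)] g[OF that(1)]]] by auto
  have mass: "measure \<nu> (space \<nu>) \<noteq> 0"
  proof
    assume "measure \<nu> (space \<nu>) = 0"
    moreover have "emeasure \<nu> (space \<nu>) \<noteq> \<infinity>"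
      using integrable_poly[of "\<lambda>_. 1"] real_polynomial_function.intros(2)[of 1]
      by (auto simp: integrable_iff_bounded top_unique less_top[symmetric])
    ultimately have "emeasure \<nu> (space \<nu>) = 0" by (simp add: measure_def enn2real_eq_0_iff)
    then have null: "AE y in \<nu>. P y" for P by (intro AE_I[of _ _ "space \<nu>"]) auto
    have zero: "(\<integral>y. F y \<partial>\<nu>) = 0" for F :: "real ^ 'm \<Rightarrow> real"
      by (rule integral_eq_zero_AE[OF null])
    obtain \<tau> where N_eq: "(\<lambda>x. of_int N - (\<Sum>i\<in>UNIV. (x $ i)\<^sup>2)) = (\<lambda>x. \<Sum>j\<le>s. \<integral>y. \<tau> j (x, y) * g j (x, y) \<partial>\<nu>)"
      using N(2) unfolding quadratic_module_def by blast
    from fun_cong[OF N_eq, of 0] show False using N(1) by (simp add: zero)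
  qed
  have "archimedean_quadratic_module ?M (of_int N)"
  proof
    fix p assume "p \<in> ?M"
    then obtain \<tau> where \<tau>: "\<forall>j\<le>s. \<tau> j \<in> sum_of_squares"
        "p = (\<lambda>x. \<Sum>j\<le>s. \<integral>y. \<tau> j (x, y) * g j (x, y) \<partial>\<nu>)"
      unfolding quadratic_module_def by blast
    have "real_polynomial_function (\<lambda>x. \<Sum>j\<le>s. \<integral>y. \<tau> j (x, y) * g j (x, y) \<partial>\<nu>)"
      using \<tau>(1) int(2) by (intro real_polynomial_function_sum) auto
    then show "real_polynomial_function p" unfolding \<tau>(2) .
    {
      fix q assume "q \<in> ?M"
      then obtain \<sigma> where \<sigma>: "\<forall>j\<le>s. \<sigma> j \<in> sum_of_squares"
        "q = (\<lambda>x. \<Sum>j\<le>s. \<integral>y. \<sigma> j (x, y) * g j (x, y) \<partial>\<nu>)"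
      unfolding quadratic_module_def by blast
      show "(\<lambda>x. p x + q x) \<in> ?M"
      proof (rule quadratic_moduleI[where \<tau> = "\<lambda>j z. \<tau> j z + \<sigma> j z"])
        show "(\<lambda>z. \<tau> j z + \<sigma> j z) \<in> sum_of_squares" if "j \<le> s" for j
          using sos_add \<tau>(1) \<sigma>(1) that by blast
        show "p x + q x = (\<Sum>j\<le>s. \<integral>y. (\<tau> j (x, y) + \<sigma> j (x, y)) * g j (x, y) \<partial>\<nu>)" for x
          unfolding \<tau>(2) \<sigma>(2) sum.distrib[symmetric]
        proof (intro sum.cong refl)
          fix j assume "j \<in> {..s}"
          then have "integrable \<nu> (\<lambda>y. \<tau> j (x, y) * g j (x, y))" "integrable \<nu> (\<lambda>y. \<sigma> j (x, y) * g j (x, y))"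
            using int(1) \<tau>(1) \<sigma>(1) by blast+
          then show "(\<integral>y. \<tau> j (x, y) * g j (x, y) \<partial>\<nu>) + (\<integral>y. \<sigma> j (x, y) * g j (x, y) \<partial>\<nu>)
              = (\<integral>y. (\<tau> j (x, y) + \<sigma> j (x, y)) * g j (x, y) \<partial>\<nu>)"
            by (simp add: distrib_right)
        qed
      qed
    }
    fix a :: "real ^ 'n \<Rightarrow> real" assume a: "real_polynomial_function a"
    show "(\<lambda>x. (a x)\<^sup>2 * p x) \<in> ?M"
    proof (rule quadratic_moduleI[where \<tau> = "\<lambda>j z. (a (fst z))\<^sup>2 * \<tau> j z"])
      show "(\<lambda>z. (a (fst z))\<^sup>2 * \<tau> j z) \<in> sum_of_squares" if "j \<le> s" for j
        using \<tau>(1) that by (intro sos_square_mult polynomial_of_fst a) blast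
      show "(a x)\<^sup>2 * p x = (\<Sum>j\<le>s. \<integral>y. (a (fst (x, y)))\<^sup>2 * \<tau> j (x, y) * g j (x, y) \<partial>\<nu>)" for x
        unfolding \<tau>(2) by (simp add: sum_distrib_left mult.assoc)
    qed
  next
    let ?c = "sqrt (1 / measure \<nu> (space \<nu>))"
    have "(\<lambda>x :: real ^ 'n. \<integral>y. (\<lambda>_. ?c\<^sup>2) (x, y) * g 0 (x, y) \<partial>\<nu>) \<in> ?M"
      by (intro quadratic_module_single sos_square real_polynomial_function.intros(2)) auto
    then show "(\<lambda>_. 1) \<in> ?M" using mass by (simp add: g0)
  next
    show "(\<lambda>x. of_int N - (norm x)\<^sup>2) \<in> ?M"
      using N(2) by (simp add: norm_vec_def L2_set_def sum_nonneg)
  qed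
  then show ?thesis by (rule that)
qed

lemma carleman_not_summable:
  fixes \<nu> :: "(real ^ 'm) measure"
  assumes carleman: "multivariate_carleman \<nu>" and b: "b \<in> Basis"
    and pos: "\<And>d. (\<integral>y. (y \<bullet> b) ^ (2 * d) \<partial>\<nu>) > 0"
  shows "\<not> summable (\<lambda>d. (\<integral>y. (y \<bullet> b) ^ (2 * Suc d) \<partial>\<nu>) powr (- 1 / (2 * real (Suc d))))"
proof
  let ?a = "\<lambda>d. (\<integral>y. (y \<bullet> b) ^ (2 * Suc d) \<partial>\<nu>) powr (- 1 / (2 * real (Suc d)))"
  assume sm: "summable ?a"
  obtain j where j: "b = axis j 1" using Basis_vec_axis[OF b] by blast
  have "carleman_term \<nu> j (Suc d) = ennreal (?a d)" for d
    using pos[of "Suc d"] unfolding carleman_term_def j inner_axis Let_def by simp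
  moreover have "(\<Sum>d. ennreal (?a d)) \<noteq> \<infinity>"
    using sm by (subst suminf_ennreal2) auto
  ultimately have "(\<Sum>d. carleman_term \<nu> j (Suc d)) \<noteq> \<infinity>" by (simp only: not_False_eq_True)
  then show False using carleman unfolding multivariate_carleman_def by blast
qed

theorem theorem3p4:
  fixes Q :: "(real ^ 'm) set"
    and s :: nat
    and g :: "nat \<Rightarrow> (real ^ 'n) \<times> (real ^ 'm) \<Rightarrow> real"
    and K :: "(real ^ 'n) set"
    and \<nu> :: "(real ^ 'm) measure"
    and f :: "real ^ 'n \<Rightarrow> real"
  assumes "closed Q"
    and "g 0 = (\<lambda>_. 1)"
    and "\<And>j. j \<in> {1..s} \<Longrightarrow> real_polynomial_function (g j)"
    and "K = {x. \<forall>y\<in>Q. \<forall>j\<in>{1..s}. g j (x, y) \<ge> 0}"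
    and "sets \<nu> = sets borel"
    and "finite_measure \<nu>"
    and "finite_moments \<nu>"
    and "measure_support \<nu> = Q"
    and "multivariate_carleman \<nu>"
    and "archimedean (quadratic_module s g \<nu>)"
    and "real_polynomial_function f"
    and "\<And>x. x \<in> K \<Longrightarrow> f x > 0"
  shows "f \<in> quadratic_module s g \<nu>"
proof -
  interpret poly_measure \<nu> by (rule poly_measure_of_moments[OF assms(5,7)])
  have g: "real_polynomial_function (g j)" if "j \<le> s" for j
    using that assms(2,3) real_polynomial_function.intros(2)[of 1] by (cases "j = 0") auto
  obtain N where "archimedean_quadratic_module (quadratic_module s g \<nu>) N"
    using quadratic_module_archimedean[OF poly_measure_axioms g assms(2,10)] by blast
  then interpret Q: archimedean_quadratic_module "quadratic_module s g \<nu>" N .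
  show ?thesis
  proof (rule Q.archimedean_positivstellensatz[OF assms(11)])
    fix x assume x: "\<And>p. p \<in> quadratic_module s g \<nu> \<Longrightarrow> p x \<ge> 0"
    have "g j (x, y) \<ge> 0" if "y \<in> Q" "j \<in> {1..s}" for y j
    proof (rule nonneg_on_support[where h = "\<lambda>y. g j (x, y)"])
      show h: "real_polynomial_function (\<lambda>y. g j (x, y))"
        using that g by (intro section_polynomial) auto
      show "poly_measure.multiplier (density \<nu> (\<lambda>y. ennreal \<bar>g j (x, y)\<bar>)) (\<lambda>y. sin (t * (y \<bullet> b)))"
        if "b \<in> Basis" "t \<ge> 0" for b t
        by (rule carleman_multiplier[OF h carleman_not_summable[OF assms(9) that(1)] that(2)])
      fix p :: "real ^ 'm \<Rightarrow> real" assume p: "real_polynomial_function p"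
      have "(\<lambda>z :: (real ^ 'n) \<times> (real ^ 'm). (p (snd z))\<^sup>2) \<in> sum_of_squares"
        by (intro sos_square polynomial_of_snd p)
      from x[OF quadratic_module_single[OF this, of j]] that(2)
      show "0 \<le> (\<integral>y. (p y)\<^sup>2 * g j (x, y) \<partial>\<nu>)" by simp
    next
      show "y \<in> measure_support \<nu>" using that(1) assms(8) by simp
    qed
    then have "x \<in> K" unfolding assms(4) by blast
    then show "f x > 0" by (rule assms(12))
  qed
qed

end
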